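(* Let $0<\alpha<1$ and let $(X,f,\mu)=([0,1],g_\alpha,\mu_\alpha)$, where $g_\alpha$ is the Liverani–Saussol–Vaienti map and $\mu_\alpha$ is its SRB probability measure. Let $H\subsetneq [0,1]$ be a measurable hole (connected or disconnected) with $\mu_\alpha(H)\in(0,1)$, and suppose that $0\notin \overline{H}$ and that $H$ has nonempty interior. Let $\tau_H(x):=\inf\{n\ge 1: g_\alpha^n(x)\in H\}$. Then $$\mu_\alpha(\tau_H>n)\approx n^{1-1/\alpha},$$ i.e. there is a constant $C\ge 1$ (independent of $n$) such that $C^{-1}n^{1-1/\alpha}\le \mu_\alpha(\{x\in[0,1]:\tau_H(x)>n\})\le C\,n^{1-1/\alpha}$ for all integers $n\ge 1$.
   Context: The Liverani–Saussol–Vaienti map $g_\alpha:[0,1]\to[0,1]$, $0<\alpha<1$, is defined by $g_\alpha(x)=x+2^{\alpha}x^{1+\alpha}$ for $0\le x\le \tfrac12$ and $g_\alpha(x)=2x-1$ for $\tfrac12<x\le 1$. It is known that $g_\alpha$ preserves an SRB probability measure $\mu_\alpha$; for this one-dimensional map this means the $g_\alpha$-invariant Borel probability measure on $[0,1]$ that is absolutely continuous with respect to Lebesgue measure. $\overline{H}$ denotes the closure of $H$ in $[0,1]$, and the interior of $H$ is taken in $[0,1]$. The first hitting time is $\tau_H(x)=\inf\{n\ge1: g_\alpha^n(x)\in H\}$, with $\inf\emptyset=+\infty$. *)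

theory Defs
  imports "HOL-Probability.Probability" "HOL-Library.Extended_Nat"
begin

text \<open>Only the values on the interval \<open>{0..1}\<close>, which the map sends into itself, are meaningful.\<close>
definition lsv :: "real \<Rightarrow> real \<Rightarrow> real" where
  "lsv \<alpha> x = (if x \<le> 1/2 then x + 2 powr \<alpha> * x powr (1 + \<alpha>) else 2 * x - 1)"

text \<open>A predicate rather than a chosen measure: for \<open>0 < \<alpha> < 1\<close> it is known that exactly one
  measure satisfies it. The underlying \<open>\<sigma>\<close>-algebra is the Borel algebra of \<open>{0..1}\<close>, so that
  \<open>space M = {0..1}\<close>.\<close>
definition lsv_SRB :: "real \<Rightarrow> real measure \<Rightarrow> bool" where
  "lsv_SRB \<alpha> M \<longleftrightarrow>
     sets M = sets (restrict_space borel {0..1}) \<and>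
     prob_space M \<and>
     lsv \<alpha> \<in> M \<rightarrow>\<^sub>M M \<and> distr M M (lsv \<alpha>) = M \<and>
     absolutely_continuous (restrict_space lborel {0..1}) M"

text \<open>In \<open>enat\<close> the infimum of the empty set is \<open>\<infinity>\<close>.\<close>
definition hitting_time :: "('a \<Rightarrow> 'a) \<Rightarrow> 'a set \<Rightarrow> 'a \<Rightarrow> enat" where
  "hitting_time f H x = Inf {enat n | n. n \<ge> 1 \<and> (f ^^ n) x \<in> H}"

end

theory Submission
  imports Defs
begin

text \<open>
Near the neutral fixed point \<open>0\<close> orbits escape slowly. Let \<open>\<delta> n\<close> be the \<open>n\<close>-th preimage of \<open>1\<close>
under the left branch. In the coordinate \<open>x powr - \<alpha>\<close> the left branch is almost a translation, so
\<open>\<delta> n\<close> is of order \<open>n powr (- 1 / \<alpha>)\<close> (\<open>\<delta>_lower\<close>, \<open>\<delta>_upper\<close>). Away from \<open>0\<close> the map mixes fast,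
and a point that avoids the hole for time \<open>n\<close> has most likely spent a time of order \<open>n\<close> near \<open>0\<close>.

Both bounds rest on the fact that \<open>\<mu>\<close> is comparable with Lebesgue measure on the interval \<open>(1/2, 1]\<close>.
To see this, consider the cone of densities \<open>u\<close> on \<open>(0, 1]\<close> such that \<open>u\<close> is decreasing and
\<open>x powr (1 + \<alpha>) * u x\<close> is increasing. The transfer operator of either branch, taken separately, maps the cone into itself (\<open>PL_cone\<close>, \<open>PR_cone\<close>), so the image of
Lebesgue measure on any cylinder has a density in the cone; and on \<open>(1/2, 1]\<close> a density in the
cone varies by a factor of at most \<open>4\<close>. The density of an invariant measure is a limit in \<open>L\<^sup>1\<close> of
combinations of indicators of cylinders, and invariance allows one to push such an approximation forward
until it lies in the cone (\<open>invariant_density_comparable\<close>).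

For the lower bound, a point of \<open>(0, \<delta> (n + M)]\<close> needs at least \<open>n\<close> steps to leave \<open>(0, \<delta> M]\<close>, where
there is no hole if \<open>M\<close> is large. By invariance \<open>\<mu>(0, \<delta> n] - \<mu>(0, \<delta> (n + 1)]\<close> is the measure of an
interval of length \<open>\<delta> n / 2\<close> in \<open>(1/2, 1]\<close>, hence at least of order \<open>n powr (- 1 / \<alpha>)\<close>; summation
from \<open>n\<close> to \<open>2 * n\<close> gives \<open>n powr (1 - 1 / \<alpha>)\<close> (\<open>m_atMost_\<delta>_lower\<close>).

For the upper bound, the hole is replaced by a finite union \<open>K\<close> of cylinders in \<open>(1/2, 1]\<close> which the map sends
into it. By invariance the measure of the set of points that avoid \<open>K\<close> up to time \<open>n\<close> decreases, from
\<open>n\<close> to \<open>n + 1\<close>, by the measure of the points of \<open>K\<close> whose image avoids \<open>K\<close> up to time \<open>n\<close>, and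
therefore by at most a multiple of the Lebesgue measure of the points that avoid \<open>K\<close> up to time \<open>n\<close>.
It remains to show that this Lebesgue measure is \<open>O(n powr (- 1 / \<alpha>))\<close> (\<open>surv_decay\<close>) and to sum.
After a visit to the right branch the density is constant up to a factor of \<open>4\<close>, so each attempt hits \<open>K\<close> with a definite probability; if it fails, the time until the
next visit to the right branch exceeds \<open>m\<close> with probability of order \<open>\<delta> m\<close>. This gives a recursive
inequality (\<open>mass_surv_step\<close>) that forces polynomial decay at the rate of \<open>\<delta>\<close>
(\<open>polynomial_decay_recursion\<close>).
\<close>

section \<open>The two branches and the preimages of the point 1\<close>

locale lsv_map =
  fixes \<alpha> :: real
  assumes alpha_pos: "0 < \<alpha>" and alpha_less_1: "\<alpha> < 1"
begin

text \<open>The left branch, extended to the whole line so that it is two-sided differentiable at the origin;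
  \<open>gl'\<close> is its derivative on the nonnegative half-line.\<close>
definition gl :: "real \<Rightarrow> real" where
  "gl x = x + (2 * \<bar>x\<bar>) powr \<alpha> * x"

definition gl' :: "real \<Rightarrow> real" where
  "gl' x = 1 + (1 + \<alpha>) * (2 * \<bar>x\<bar>) powr \<alpha>"

lemma lsv_left: "lsv \<alpha> x = gl x" if "0 \<le> x" "x \<le> 1/2"
proof -
  have "x powr (1 + \<alpha>) = x * x powr \<alpha>"
    using that by (cases "x = 0") (auto simp: powr_add)
  then show ?thesis
    using that by (simp add: lsv_def gl_def powr_mult)
qed

lemma lsv_right: "lsv \<alpha> x = 2 * x - 1" if "1/2 < x"
  using that by (simp add: lsv_def)

lemma lsv_measurable [measurable]: "lsv \<alpha> \<in> borel_measurable borel"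
  unfolding lsv_def by measurable

lemma funpow_lsv_measurable [measurable]: "(lsv \<alpha> ^^ n) \<in> borel_measurable borel"
proof (induction n)
  case 0
  then show ?case by (simp add: id_def)
next
  case (Suc n)
  have "(\<lambda>x. lsv \<alpha> ((lsv \<alpha> ^^ n) x)) \<in> borel_measurable borel"
    using Suc by (rule measurable_compose) measurable
  then show ?case by (simp add: comp_def)
qed

lemma gl_deriv: "(gl has_real_derivative gl' x) (at x)" if "0 \<le> x"
proof (cases "x = 0")
  case True
  have "((\<lambda>h. 1 + (2 * \<bar>h\<bar>) powr \<alpha>) \<longlongrightarrow> 1 + (2 * \<bar>0\<bar>) powr \<alpha>) (at (0::real))"
    using alpha_pos by (intro tendsto_intros) auto
  moreover have "eventually (\<lambda>h. 1 + (2 * \<bar>h\<bar>) powr \<alpha> = (gl (0 + h) - gl 0) / h) (at 0)"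
    by (auto simp: eventually_at gl_def field_simps intro!: exI[of _ 1])
  ultimately have "((\<lambda>h. (gl (0 + h) - gl 0) / h) \<longlongrightarrow> 1) (at 0)"
    using alpha_pos by (simp add: tendsto_cong)
  then show ?thesis
    using True by (simp add: DERIV_def gl'_def)
next
  case False
  with that have x: "x > 0" by simp
  have "((\<lambda>x. x + (2 * x) powr \<alpha> * x) has_real_derivative gl' x) (at x)"
    using x by (auto intro!: derivative_eq_intros simp: gl'_def powr_diff field_simps)
  moreover have "\<forall>\<^sub>F y in nhds x. y + (2 * y) powr \<alpha> * y = gl y"
    using eventually_nhds_in_open[of "{0<..}" x] x
    by (auto elim!: eventually_mono simp: gl_def)
  ultimately show ?thesis
    by (subst DERIV_cong_ev[OF refl _ refl, symmetric])
qed

lemma gl'_ge_1: "1 \<le> gl' x"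
  using alpha_pos by (simp add: gl'_def)

lemma gl'_mono: "gl' x \<le> gl' y" if "0 \<le> x" "x \<le> y"
  using that alpha_pos by (auto simp: gl'_def intro!: mult_left_mono powr_mono2)

lemma gl'_continuous: "continuous_on A gl'"
  unfolding gl'_def using alpha_pos by (intro continuous_intros continuous_on_powr') auto

lemma gl_0 [simp]: "gl 0 = 0" and gl_half [simp]: "gl (1/2) = 1"
  by (simp_all add: gl_def)

text \<open>A convex function that vanishes at the origin is superadditive. Hence the left preimages of
  intervals of a given length are longest at the origin.\<close>
lemma gl_superadditive: "gl x + gl y \<le> gl (x + y)" if "0 \<le> x" "0 \<le> y"
proof -
  have "(2 * \<bar>x\<bar>) powr \<alpha> * x \<le> (2 * \<bar>x + y\<bar>) powr \<alpha> * x"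
    "(2 * \<bar>y\<bar>) powr \<alpha> * y \<le> (2 * \<bar>x + y\<bar>) powr \<alpha> * y"
    using that alpha_pos by (auto intro!: mult_right_mono powr_mono2)
  then show ?thesis
    by (simp add: gl_def algebra_simps)
qed

lemma gl_pos: "0 < gl x" if "0 < x"
  using that by (simp add: gl_def add_pos_nonneg)

lemma gl_strict_mono: "gl x < gl y" if "0 \<le> x" "x < y"
  using gl_superadditive[of x "y - x"] gl_pos[of "y - x"] that by simp

lemma gl_less_iff: "gl x < gl y \<longleftrightarrow> x < y" if "0 \<le> x" "0 \<le> y"
  using gl_strict_mono[of x y] gl_strict_mono[of y x] that by (cases x y rule: linorder_cases) auto

lemma gl_le_iff: "gl x \<le> gl y \<longleftrightarrow> x \<le> y" if "0 \<le> x" "0 \<le> y"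
  using gl_less_iff[of y x] that by (auto simp: not_less[symmetric])

lemma gl_ge: "x \<le> gl x" if "0 \<le> x"
  using that by (simp add: gl_def)

lemma gl_le_double: "gl x \<le> 2 * x" if "0 \<le> x" "x \<le> 1/2"
proof -
  have "(2 * \<bar>x\<bar>) powr \<alpha> \<le> 1"
    using that alpha_pos by (intro powr_le1) auto
  then have "(2 * \<bar>x\<bar>) powr \<alpha> * x \<le> 1 * x"
    using that by (intro mult_right_mono) auto
  then show ?thesis by (simp add: gl_def)
qed

lemma gl_surj:
  assumes "0 \<le> y" "y \<le> 1"
  obtains x where "0 \<le> x" "x \<le> 1/2" "gl x = y"
proof -
  have "continuous_on {0..1/2} gl"
    using gl_deriv by (intro continuous_at_imp_continuous_on ballI DERIV_isCont) auto
  with IVT'[of gl 0 y "1/2"] assms that show ?thesis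
    by auto
qed

text \<open>The inverse of the left branch.\<close>
definition L :: "real \<Rightarrow> real" where
  "L y = (THE x. 0 \<le> x \<and> x \<le> 1/2 \<and> gl x = y)"

lemma L_eqI: "L y = x" if "0 \<le> x" "x \<le> 1/2" "gl x = y"
  unfolding L_def using that gl_strict_mono
  by (intro the_equality) (auto, metis linorder_neqE_linordered_idom order_less_irrefl)

lemma L_gl [simp]: "L (gl x) = x" if "0 \<le> x" "x \<le> 1/2"
  using L_eqI that by blast

lemma L: assumes "0 \<le> y" "y \<le> 1" shows "0 \<le> L y" "L y \<le> 1/2" "gl (L y) = y"
  using gl_surj[OF assms] L_gl by metis+

lemma L_mono: "L x \<le> L y" if "0 \<le> x" "x \<le> y" "y \<le> 1"
  using gl_le_iff[of "L x" "L y"] L[of x] L[of y] that by auto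

lemma L_pos: "0 < L y" if "0 < y" "y \<le> 1"
  using L[of y] that by (cases "L y = 0") auto

lemma lsv_range: "lsv \<alpha> x \<in> {0<..1}" if "x \<in> {0<..1}"
proof (cases "x \<le> 1/2")
  case True
  then show ?thesis
    using that gl_pos[of x] gl_le_iff[of x "1/2"] by (auto simp: lsv_left)
next
  case False
  then show ?thesis using that by (auto simp: lsv_right)
qed

lemma funpow_lsv_range: "(lsv \<alpha> ^^ n) x \<in> {0<..1}" if "x \<in> {0<..1}"
  by (induction n) (use that lsv_range in auto)

text \<open>The cylinder of words \<open>left, ..., left\<close> of length \<open>n\<close> is \<open>{0<..\<delta> n}\<close>.\<close>
fun \<delta> :: "nat \<Rightarrow> real" where
  "\<delta> 0 = 1"
| "\<delta> (Suc n) = L (\<delta> n)"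

lemma \<delta>_range: "0 < \<delta> n \<and> \<delta> n \<le> 1"
proof (induction n)
  case (Suc n)
  then show ?case using L_pos[of "\<delta> n"] L[of "\<delta> n"] by auto
qed simp

lemma \<delta>_pos: "0 < \<delta> n" and \<delta>_le_1: "\<delta> n \<le> 1"
  using \<delta>_range by auto

lemma \<delta>_Suc_le_half: "\<delta> (Suc n) \<le> 1/2" and gl_\<delta>_Suc: "gl (\<delta> (Suc n)) = \<delta> n"
  using L[of "\<delta> n"] \<delta>_range[of n] by auto

lemma \<delta>_Suc_le: "\<delta> (Suc n) \<le> \<delta> n"
  using gl_ge[of "\<delta> (Suc n)"] gl_\<delta>_Suc[of n] \<delta>_pos[of "Suc n"] by linarith

lemma \<delta>_antimono: "\<delta> n \<le> \<delta> m" if "m \<le> n"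
  using lift_Suc_antimono_le[of \<delta>] \<delta>_Suc_le that by blast

text \<open>A step on the left branch at most doubles, so an interval of length at most \<open>\<delta> n\<close> has a right
  preimage of length at most \<open>\<delta> (Suc n)\<close>.\<close>
lemma \<delta>_half_le: "\<delta> n / 2 \<le> \<delta> (Suc n)"
  using gl_le_double[of "\<delta> (Suc n)"] gl_\<delta>_Suc[of n] \<delta>_pos[of "Suc n"] \<delta>_Suc_le_half[of n] by linarith

text \<open>In the coordinate \<open>x powr - \<alpha>\<close> the left branch moves points by an amount that is bounded
  and bounded away from zero, hence the orbit of the preimages of \<open>1\<close> is asymptotically
  an arithmetic progression.\<close>
lemma \<delta>_step:
  defines "z \<equiv> \<lambda>n. \<delta> n powr - \<alpha>"
  shows "z n + \<alpha> * 2 powr (2 * \<alpha> - 2) \<le> z (Suc n)" "z (Suc n) \<le> z n + \<alpha> * 2 powr \<alpha>"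
proof -
  define x where "x = \<delta> (Suc n)"
  define t where "t = (2 * x) powr \<alpha>"
  have x: "0 < x" "x \<le> 1/2" and dn: "\<delta> n = (1 + t) * x"
    using \<delta>_pos[of "Suc n"] \<delta>_Suc_le_half[of n] gl_\<delta>_Suc[of n]
    by (auto simp: x_def t_def gl_def algebra_simps)
  have t: "0 < t" "t \<le> 1"
    using x alpha_pos by (auto simp: t_def intro!: powr_le1)
  \<comment> \<open>Here \<open>1 + t\<close> is the factor by which the left branch expands \<open>\<delta> (Suc n)\<close>, so the increment of
    \<open>z\<close> is \<open>z n * ((1 + t) powr \<alpha> - 1)\<close>; since \<open>t\<close> is inversely proportional to \<open>z (Suc n)\<close>,
    this is of order \<open>1\<close> by the mean value theorem.\<close>
  have zS: "z (Suc n) = (1 + t) powr \<alpha> * z n"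
    using x t unfolding z_def x_def[symmetric] dn by (simp add: powr_mult powr_minus)
  have zt: "z (Suc n) * t = 2 powr \<alpha>"
    using x unfolding z_def x_def[symmetric] t_def by (simp add: powr_mult powr_minus)
  have zpos: "0 < z n" using \<delta>_pos[of n] by (simp add: z_def)
  have "\<exists>\<xi>>1. \<xi> < 1 + t \<and> (1 + t) powr \<alpha> - 1 powr \<alpha> = (1 + t - 1) * (\<alpha> * \<xi> powr (\<alpha> - 1))"
    using t by (intro MVT2) (auto intro!: derivative_eq_intros simp: powr_diff)
  then obtain \<xi> where \<xi>: "1 < \<xi>" "\<xi> < 1 + t" "(1 + t) powr \<alpha> - 1 = t * (\<alpha> * \<xi> powr (\<alpha> - 1))"
    by auto
  have "2 powr (\<alpha> - 1) \<le> \<xi> powr (\<alpha> - 1)"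
    using \<xi> t alpha_less_1 by (intro powr_mono2') auto
  moreover have "\<xi> powr (\<alpha> - 1) \<le> 1 powr (\<alpha> - 1)"
    using \<xi> t alpha_less_1 by (intro powr_mono2') auto
  ultimately have lo: "t * (\<alpha> * 2 powr (\<alpha> - 1)) \<le> (1 + t) powr \<alpha> - 1"
    and up: "(1 + t) powr \<alpha> - 1 \<le> t * \<alpha>"
    using \<xi>(3) t alpha_pos by (auto intro!: mult_left_mono)
  have "(1 + t) powr \<alpha> \<le> 2 powr 1"
    using t alpha_pos alpha_less_1 by (intro order_trans[OF powr_mono2[of \<alpha> "1 + t" 2]] powr_mono) auto
  then have z2: "z (Suc n) \<le> 2 * z n"
    using zS zpos by simp
  have zS': "z (Suc n) - z n = ((1 + t) powr \<alpha> - 1) * z n"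
    by (simp add: zS algebra_simps)
  have "\<alpha> * 2 powr (2 * \<alpha> - 2) = \<alpha> * 2 powr (\<alpha> - 1) * (z (Suc n) * t / 2)"
    unfolding zt by (simp add: powr_diff powr_add[symmetric] field_simps)
  also have "\<dots> \<le> \<alpha> * 2 powr (\<alpha> - 1) * (z n * t)"
    using z2 t alpha_pos by (intro mult_left_mono) (auto simp: field_simps)
  also have "\<dots> = t * (\<alpha> * 2 powr (\<alpha> - 1)) * z n" by simp
  also have "\<dots> \<le> z (Suc n) - z n"
    unfolding zS' using lo zpos by (intro mult_right_mono) auto
  finally show "z n + \<alpha> * 2 powr (2 * \<alpha> - 2) \<le> z (Suc n)" by simp
  have "z n \<le> z (Suc n)"
    using zS zpos t alpha_pos by (simp add: ge_one_powr_ge_zero)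
  have "z (Suc n) - z n \<le> t * \<alpha> * z n"
    unfolding zS' using up zpos by (intro mult_right_mono) auto
  also have "\<dots> \<le> t * \<alpha> * z (Suc n)"
    using \<open>z n \<le> z (Suc n)\<close> t alpha_pos by (intro mult_left_mono) auto
  also have "\<dots> = \<alpha> * 2 powr \<alpha>" using zt by (simp add: mult_ac)
  finally show "z (Suc n) \<le> z n + \<alpha> * 2 powr \<alpha>" by simp
qed

lemma \<delta>_powr_bounds:
  defines "a \<equiv> \<alpha> * 2 powr (2 * \<alpha> - 2)" and "b \<equiv> \<alpha> * 2 powr \<alpha>"
  shows "1 + a * real n \<le> \<delta> n powr - \<alpha>" "\<delta> n powr - \<alpha> \<le> 1 + b * real n"
proof -
  have "1 + a * real n \<le> \<delta> n powr - \<alpha> \<and> \<delta> n powr - \<alpha> \<le> 1 + b * real n"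
  proof (induction n)
    case (Suc n)
    then show ?case
      using \<delta>_step[of n] unfolding a_def[symmetric] b_def[symmetric]
      by (auto simp: algebra_simps)
  qed simp
  then show "1 + a * real n \<le> \<delta> n powr - \<alpha>" "\<delta> n powr - \<alpha> \<le> 1 + b * real n" by auto
qed

lemma \<delta>_eq_powr: "\<delta> n = (\<delta> n powr - \<alpha>) powr (- 1 / \<alpha>)"
  using \<delta>_pos[of n] alpha_pos by (simp add: powr_powr)

lemma \<delta>_lower: "\<exists>c>0. \<forall>n\<ge>1. c * real n powr (- 1 / \<alpha>) \<le> \<delta> n"
proof (intro exI conjI allI impI)
  define b where "b = \<alpha> * 2 powr \<alpha>"
  have b: "0 < b" using alpha_pos by (simp add: b_def)
  then show "0 < (1 + b) powr (- 1 / \<alpha>)" by simp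
  fix n :: nat assume n: "1 \<le> n"
  have "\<delta> n powr - \<alpha> \<le> (1 + b) * real n"
    using \<delta>_powr_bounds(2)[of n] n unfolding b_def[symmetric] by (simp add: algebra_simps)
  then have "((1 + b) * real n) powr (- 1 / \<alpha>) \<le> (\<delta> n powr - \<alpha>) powr (- 1 / \<alpha>)"
    using alpha_pos \<delta>_pos[of n] by (intro powr_mono2') auto
  then show "(1 + b) powr (- 1 / \<alpha>) * real n powr (- 1 / \<alpha>) \<le> \<delta> n"
    using b n \<delta>_eq_powr[of n] by (simp add: powr_mult)
qed

lemma \<delta>_upper: "\<exists>C>0. \<forall>n\<ge>1. \<delta> n \<le> C * real n powr (- 1 / \<alpha>)"
proof (intro exI conjI allI impI)
  define a where "a = \<alpha> * 2 powr (2 * \<alpha> - 2)"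
  have a: "0 < a" using alpha_pos by (simp add: a_def)
  then show "0 < a powr (- 1 / \<alpha>)" by simp
  fix n :: nat assume n: "1 \<le> n"
  have "(\<delta> n powr - \<alpha>) powr (- 1 / \<alpha>) \<le> (a * real n) powr (- 1 / \<alpha>)"
    using alpha_pos a n \<delta>_powr_bounds(1)[of n] unfolding a_def[symmetric]
    by (intro powr_mono2') auto
  then show "\<delta> n \<le> a powr (- 1 / \<alpha>) * real n powr (- 1 / \<alpha>)"
    using a n \<delta>_eq_powr[of n] by (simp add: powr_mult)
qed

lemma \<delta>_tendsto_0: "\<delta> \<longlonglongrightarrow> 0"
proof -
  obtain C where C: "\<And>n. 1 \<le> n \<Longrightarrow> \<delta> n \<le> C * real n powr (- 1 / \<alpha>)"
    using \<delta>_upper by blast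
  have "(\<lambda>n. C * real n powr (- 1 / \<alpha>)) \<longlonglongrightarrow> C * 0"
    using alpha_pos by (intro tendsto_mult tendsto_const tendsto_neg_powr filterlim_real_sequentially) auto
  then have lim: "(\<lambda>n. C * real n powr (- 1 / \<alpha>)) \<longlonglongrightarrow> 0" by simp
  have "\<forall>\<^sub>F n in sequentially. 0 \<le> \<delta> n"
    using \<delta>_pos by (simp add: less_imp_le)
  moreover have "\<forall>\<^sub>F n in sequentially. \<delta> n \<le> C * real n powr (- 1 / \<alpha>)"
    using C by (rule eventually_sequentiallyI)
  ultimately show ?thesis
    by (rule tendsto_sandwich[OF _ _ tendsto_const lim])
qed

section \<open>A cone of densities with bounded distortion\<close>

text \<open>Values outside \<open>{0<..1}\<close> are set to \<open>0\<close>, so that integrals may be taken over arbitrary Borel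
  subsets of the line. Members may have a nonintegrable singularity at the origin.\<close>
definition cone :: "(real \<Rightarrow> real) set" where
  "cone = {u. (\<forall>x. 0 \<le> u x) \<and> (\<forall>x. x \<notin> {0<..1} \<longrightarrow> u x = 0) \<and>
     (\<forall>x y. 0 < x \<longrightarrow> x \<le> y \<longrightarrow> y \<le> 1 \<longrightarrow>
        u y \<le> u x \<and> x powr (1 + \<alpha>) * u x \<le> y powr (1 + \<alpha>) * u y)}"

lemma coneI:
  assumes "\<And>x. 0 \<le> u x" "\<And>x. x \<notin> {0<..1} \<Longrightarrow> u x = 0"
    and "\<And>x y. 0 < x \<Longrightarrow> x \<le> y \<Longrightarrow> y \<le> 1 \<Longrightarrow> u y \<le> u x"
    and "\<And>x y. 0 < x \<Longrightarrow> x \<le> y \<Longrightarrow> y \<le> 1 \<Longrightarrow>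
      x powr (1 + \<alpha>) * u x \<le> y powr (1 + \<alpha>) * u y"
  shows "u \<in> cone"
  using assms by (auto simp: cone_def)

lemma coneD:
  assumes "u \<in> cone"
  shows "0 \<le> u x" "x \<notin> {0<..1} \<Longrightarrow> u x = 0"
    and "0 < x \<Longrightarrow> x \<le> y \<Longrightarrow> y \<le> 1 \<Longrightarrow> u y \<le> u x"
    and "0 < x \<Longrightarrow> x \<le> y \<Longrightarrow> y \<le> 1 \<Longrightarrow> x powr (1 + \<alpha>) * u x \<le> y powr (1 + \<alpha>) * u y"
  using assms by (auto simp: cone_def)

lemma cone_add: "(\<lambda>x. u x + v x) \<in> cone" if "u \<in> cone" "v \<in> cone"
  using that coneD[OF that(1)] coneD[OF that(2)]
  by (intro coneI) (auto simp: distrib_left intro!: add_mono)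

lemma cone_scale: "(\<lambda>x. c * u x) \<in> cone" if "u \<in> cone" "0 \<le> c"
proof (rule coneI)
  fix x y :: real
  assume "0 < x" "x \<le> y" "y \<le> 1"
  then show "x powr (1 + \<alpha>) * (c * u x) \<le> y powr (1 + \<alpha>) * (c * u y)"
    using coneD(4)[OF that(1), of x y] mult_left_mono[OF _ that(2)] by (simp add: mult.left_commute)
qed (use that coneD[OF that(1)] in \<open>auto intro!: mult_left_mono\<close>)

lemma cone_one: "indicator {0<..1} \<in> cone"
  using alpha_pos by (intro coneI) (auto simp: indicator_def intro!: powr_mono2)

lemma cone_zero: "(\<lambda>x. 0) \<in> cone"
  by (intro coneI) auto

lemma cone_measurable [measurable_dest]: "u \<in> borel_measurable borel" if "u \<in> cone"
proof -
  have "mono_on {0<..1} (\<lambda>x. - u x)"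
    using coneD(3)[OF that] by (auto simp: mono_on_def)
  then have "(\<lambda>x. - u x) \<in> borel_measurable (restrict_space borel {0<..1})"
    by (rule borel_measurable_mono_on_fnc)
  then have "(\<lambda>x. - (indicator {0<..1} x *\<^sub>R (- u x))) \<in> borel_measurable borel"
    by (subst (asm) borel_measurable_restrict_space_iff) auto
  moreover have "(\<lambda>x. - (indicator {0<..1} x *\<^sub>R (- u x))) = u"
    using coneD(2)[OF that] by (auto simp: indicator_def fun_eq_iff)
  ultimately show ?thesis by simp
qed

text \<open>Comparing the weighted density at \<open>x\<close> and at \<open>1\<close> gives
  \<open>u x \<le> 2 powr (1 + \<alpha>) * u 1\<close>; the constant \<open>4\<close> works for all \<open>\<alpha> < 1\<close>.\<close>
lemma cone_bound: "u x \<le> 4 * u 1" if "u \<in> cone" "1/2 < x"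
proof (cases "x \<le> 1")
  case True
  have "1 \<le> 4 * x powr (1 + \<alpha>)"
  proof -
    have "(1/2::real) powr 2 \<le> (1/2) powr (1 + \<alpha>)"
      using alpha_less_1 by (intro powr_mono') auto
    also have "\<dots> \<le> x powr (1 + \<alpha>)"
      using that alpha_pos by (intro powr_mono2) auto
    finally show ?thesis by (simp add: powr_numeral power2_eq_square)
  qed
  then have "1 * u x \<le> 4 * x powr (1 + \<alpha>) * u x"
    using coneD(1)[OF that(1)] by (rule mult_right_mono)
  also have "\<dots> \<le> 4 * u 1"
    using coneD(4)[OF that(1), of x 1] that True by simp
  finally show ?thesis by simp
next
  case False
  then show ?thesis using coneD(1,2)[OF that(1)] by simp
qed

text \<open>The densities seen right after a visit to the right branch (\<open>PR_flat_cone\<close> below): they have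
  bounded distortion on all of \<open>{0<..1}\<close>, not only on the right half.\<close>
definition flat_cone :: "(real \<Rightarrow> real) set" where
  "flat_cone = {u \<in> cone. \<forall>x. u x \<le> 4 * u 1}"

definition mass :: "(real \<Rightarrow> real) \<Rightarrow> real set \<Rightarrow> ennreal" where
  "mass u A = (\<integral>\<^sup>+x\<in>A. ennreal (u x) \<partial>lborel)"

lemma mass_mono: "mass u A \<le> mass u B" if "A \<inter> {0<..1} \<subseteq> B" "u \<in> cone"
  unfolding mass_def
proof (intro nn_integral_mono)
  show "ennreal (u x) * indicator A x \<le> ennreal (u x) * indicator B x" for x
    using that coneD(2)[OF that(2), of x] by (cases "x \<in> {0<..1}") (auto simp: indicator_def)
qed

lemma mass_cong: "mass u A = mass u B" if "A \<inter> {0<..1} = B \<inter> {0<..1}" "u \<in> cone"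
  using that by (intro antisym mass_mono) auto

lemma mass_Un:
  assumes "u \<in> cone" "A \<in> sets borel" "B \<in> sets borel" "A \<inter> B = {}"
  shows "mass u (A \<union> B) = mass u A + mass u B"
  unfolding mass_def using assms cone_measurable[OF assms(1)]
  by (intro nn_integral_disjoint_pair) auto

lemma mass_add:
  assumes "u \<in> cone" "v \<in> cone" "A \<in> sets borel"
  shows "mass (\<lambda>x. u x + v x) A = mass u A + mass v A"
proof -
  note [measurable] = cone_measurable[OF assms(1)] cone_measurable[OF assms(2)] assms(3)
  show ?thesis
    unfolding mass_def using coneD(1)[OF assms(1)] coneD(1)[OF assms(2)]
    by (subst nn_integral_add[symmetric])
       (auto intro!: nn_integral_cong simp: indicator_def ennreal_plus)
qed

lemma mass_scale:
  assumes "u \<in> cone" "A \<in> sets borel" "0 \<le> c"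
  shows "mass (\<lambda>x. c * u x) A = ennreal c * mass u A"
proof -
  note [measurable] = cone_measurable[OF assms(1)] assms(2)
  show ?thesis
    unfolding mass_def using coneD(1)[OF assms(1)] assms(3)
    by (subst nn_integral_cmult[symmetric])
       (auto intro!: nn_integral_cong simp: indicator_def ennreal_mult)
qed

lemma mass_zero [simp]: "mass (\<lambda>x. 0) A = 0"
  by (simp add: mass_def)

lemma mass_one: "mass (indicator {0<..1}) A = emeasure lborel (A \<inter> {0<..1})"
  if "A \<in> sets borel"
proof -
  have "mass (indicator {0<..1}) A = (\<integral>\<^sup>+x. indicator (A \<inter> {0<..1}) x \<partial>lborel)"
    unfolding mass_def by (intro nn_integral_cong) (auto simp: indicator_def)
  then show ?thesis using that by simp
qed

lemma mass_le:
  assumes "\<And>x. x \<in> A \<inter> {0<..1} \<Longrightarrow> u x \<le> c" "u \<in> cone" "A \<in> sets borel" "0 \<le> c"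
  shows "mass u A \<le> ennreal c * emeasure lborel (A \<inter> {0<..1})"
proof -
  have "mass u A \<le> (\<integral>\<^sup>+x. ennreal c * indicator (A \<inter> {0<..1}) x \<partial>lborel)"
    unfolding mass_def using assms(1) coneD(2)[OF assms(2)]
    by (intro nn_integral_mono) (auto simp: indicator_def ennreal_leI)
  then show ?thesis using assms(3) by (simp add: nn_integral_cmult)
qed

lemma mass_ge:
  assumes "u \<in> cone" "A \<in> sets borel"
  shows "ennreal (u 1) * emeasure lborel (A \<inter> {0<..1}) \<le> mass u A"
proof -
  have "(\<integral>\<^sup>+x. ennreal (u 1) * indicator (A \<inter> {0<..1}) x \<partial>lborel) \<le> mass u A"
    unfolding mass_def using coneD(3)[OF assms(1), of _ 1]
    by (intro nn_integral_mono) (auto simp: indicator_def ennreal_leI)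
  then show ?thesis using assms by (simp add: nn_integral_cmult)
qed

text \<open>A symmetric form of the distortion bound: it contains the upper and the lower density bounds,
  for \<open>B\<close> respectively \<open>A\<close> the whole right half.\<close>
lemma cone_distortion:
  assumes u: "u \<in> cone" and A: "A \<in> sets borel" "A \<subseteq> {1/2<..1}"
    and B: "B \<in> sets borel" "B \<subseteq> {1/2<..1}"
  shows "emeasure lborel B * mass u A \<le> 4 * emeasure lborel A * mass u B"
proof -
  have AB: "A \<inter> {0<..1} = A" "B \<inter> {0<..1} = B" using A B by auto
  have "emeasure lborel B * mass u A \<le> emeasure lborel B * (ennreal (4 * u 1) * emeasure lborel A)"
  proof (intro mult_left_mono)
    show "mass u A \<le> ennreal (4 * u 1) * emeasure lborel A"
      using mass_le[of A u "4 * u 1"] cone_bound[OF u] u A coneD(1)[OF u, of 1] unfolding AB(1)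
      by force
  qed simp
  also have "\<dots> = 4 * emeasure lborel A * (ennreal (u 1) * emeasure lborel B)"
    using coneD(1)[OF u] by (simp add: ennreal_mult mult_ac)
  also have "\<dots> \<le> 4 * emeasure lborel A * mass u B"
    using mass_ge[OF u B(1)] AB by (intro mult_left_mono) auto
  finally show ?thesis .
qed

section \<open>Transfer of densities along the two branches\<close>

text \<open>The parts of the transfer operator that belong to the left and to the right branch. Keeping them
  apart is essential, since the restriction of a density to a cylinder follows a single branch at
  each step.\<close>
definition PL :: "(real \<Rightarrow> real) \<Rightarrow> real \<Rightarrow> real" where
  "PL u y = (if y \<in> {0<..1} then u (L y) / gl' (L y) else 0)"

definition PR :: "(real \<Rightarrow> real) \<Rightarrow> real \<Rightarrow> real" where
  "PR u y = (if y \<in> {0<..1} then u ((1 + y) / 2) / 2 else 0)"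

text \<open>With \<open>t = (2 * x) powr \<alpha>\<close> the quotient below is \<open>(gl x / x) powr (1 + \<alpha>) / gl' x\<close>.\<close>
lemma distortion_quotient_mono:
  assumes "0 \<le> s" "s \<le> t"
  shows "(1 + s) powr (1 + \<alpha>) / (1 + (1 + \<alpha>) * s) \<le> (1 + t) powr (1 + \<alpha>) / (1 + (1 + \<alpha>) * t)"
proof (rule DERIV_nonneg_imp_nondecreasing[OF assms(2)])
  fix x assume "s \<le> x" "x \<le> t"
  then have x: "0 \<le> x" using assms by simp
  have D: "0 < 1 + (1 + \<alpha>) * x" using x alpha_pos by (simp add: add_pos_nonneg)
  let ?d = "((1 + \<alpha>) * (1 + x) powr \<alpha> * (1 + (1 + \<alpha>) * x) - (1 + x) powr (1 + \<alpha>) * (1 + \<alpha>))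
      / (1 + (1 + \<alpha>) * x)\<^sup>2"
  have D': "((\<lambda>t. (1 + t) powr (1 + \<alpha>) / (1 + (1 + \<alpha>) * t)) has_real_derivative ?d) (at x)"
    using x D by (auto intro!: derivative_eq_intros simp: power2_eq_square)
  have "?d = (1 + \<alpha>) * (1 + x) powr \<alpha> * (\<alpha> * x) / (1 + (1 + \<alpha>) * x)\<^sup>2"
    using x by (simp add: powr_add algebra_simps)
  moreover have "0 \<le> (1 + \<alpha>) * (1 + x) powr \<alpha> * (\<alpha> * x) / (1 + (1 + \<alpha>) * x)\<^sup>2"
    using x alpha_pos by simp
  ultimately have "0 \<le> ?d" by (simp only:)
  then show "\<exists>y. ((\<lambda>t. (1 + t) powr (1 + \<alpha>) / (1 + (1 + \<alpha>) * t)) has_real_derivative y) (at x) \<and> 0 \<le> y"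
    using D' by (intro exI conjI)
qed

text \<open>Monotonicity of the density survives because the left branch is convex. For the weighted
  density, the factor by which the weight changes is the quotient of \<open>distortion_quotient_mono\<close>;
  it increases in \<open>x\<close>, and this is what singles out the exponent \<open>1 + \<alpha>\<close>.\<close>
lemma PL_cone: "PL u \<in> cone" if u: "u \<in> cone"
proof (rule coneI)
  show "0 \<le> PL u x" for x
    using coneD(1)[OF u] gl'_ge_1[of "L x"] by (simp add: PL_def)
  fix x y :: real assume xy: "0 < x" "x \<le> y" "y \<le> 1"
  define a b where "a = L x" and "b = L y"
  have ab: "0 < a" "a \<le> b" "b \<le> 1/2" "gl a = x" "gl b = y"
    using xy L[of x] L[of y] L_pos[of x] L_mono[of x y] by (auto simp: a_def b_def)
  have P: "PL u x = u a / gl' a" "PL u y = u b / gl' b"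
    using xy by (auto simp: PL_def a_def b_def)
  show "PL u y \<le> PL u x"
    unfolding P using ab gl'_ge_1[of a] gl'_mono[of a b] coneD(1)[OF u] coneD(3)[OF u, of a b]
    by (intro frac_le) auto
  define q where "q c = (1 + (2 * c) powr \<alpha>) powr (1 + \<alpha>) / gl' c" for c
  have q: "0 \<le> q a" "q a \<le> q b"
    using ab distortion_quotient_mono[of "(2 * a) powr \<alpha>" "(2 * b) powr \<alpha>"] gl'_ge_1[of a] alpha_pos
    by (auto simp: q_def gl'_def powr_mono2)
  have factor: "gl c powr (1 + \<alpha>) * (u c / gl' c) = c powr (1 + \<alpha>) * u c * q c" if "0 < c" for c
  proof -
    have "gl c = c * (1 + (2 * c) powr \<alpha>)" using that by (simp add: gl_def algebra_simps)
    then show ?thesis using that by (simp add: powr_mult q_def)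
  qed
  have "x powr (1 + \<alpha>) * PL u x = a powr (1 + \<alpha>) * u a * q a"
    using factor[of a] ab P by simp
  also have "\<dots> \<le> b powr (1 + \<alpha>) * u b * q b"
    using ab q coneD(4)[OF u, of a b] coneD(1)[OF u]
    by (intro mult_mono[of _ _ "q a"]) auto
  also have "\<dots> = y powr (1 + \<alpha>) * PL u y"
    using factor[of b] ab P by simp
  finally show "x powr (1 + \<alpha>) * PL u x \<le> y powr (1 + \<alpha>) * PL u y" .
qed (auto simp: PL_def)

lemma PR_cone: "PR u \<in> cone" if u: "u \<in> cone"
proof (rule coneI)
  show "0 \<le> PR u x" for x
    using coneD(1)[OF u] by (simp add: PR_def)
  fix x y :: real assume xy: "0 < x" "x \<le> y" "y \<le> 1"
  define a b where "a = (1 + x) / 2" and "b = (1 + y) / 2"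
  have ab: "1/2 < a" "a \<le> b" "b \<le> 1" "2 * a - 1 = x" "2 * b - 1 = y"
    using xy by (auto simp: a_def b_def field_simps)
  have P: "PR u x = u a / 2" "PR u y = u b / 2"
    using xy by (auto simp: PR_def a_def b_def)
  show "PR u y \<le> PR u x"
    unfolding P using ab coneD(3)[OF u, of a b] by simp
  have "x / a = 2 - 1 / a" "y / b = 2 - 1 / b"
    using ab by (auto simp: field_simps)
  moreover have "1 / b \<le> 1 / a"
    using ab by (intro divide_left_mono) auto
  ultimately have "x / a \<le> y / b" by simp
  then have "(x / a) powr (1 + \<alpha>) * (a powr (1 + \<alpha>) * u a / 2)
      \<le> (y / b) powr (1 + \<alpha>) * (b powr (1 + \<alpha>) * u b / 2)"
    using ab xy coneD(4)[OF u, of a b] coneD(1)[OF u] alpha_pos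
    by (intro mult_mono[of "(x / a) powr (1 + \<alpha>)"] powr_mono2 divide_right_mono) auto
  then show "x powr (1 + \<alpha>) * PR u x \<le> y powr (1 + \<alpha>) * PR u y"
    unfolding P using ab xy by (simp add: powr_divide)
qed (auto simp: PR_def)

text \<open>The right branch reads the density on \<open>{1/2<..1}\<close> only, where \<open>cone_bound\<close> applies.\<close>
lemma PR_flat_cone: "PR u \<in> flat_cone" if "u \<in> cone"
  using PR_cone[OF that] cone_bound[OF that] coneD(1)[OF that]
  by (auto simp: flat_cone_def PR_def)

lemma mass_PL:
  assumes u: "u \<in> cone" and A [measurable]: "A \<in> sets borel"
  shows "mass (PL u) A = mass u ({..1/2} \<inter> lsv \<alpha> -` A)"
proof -
  note [measurable] = cone_measurable[OF PL_cone[OF u]]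
  define f where "f y = ennreal (PL u y) * indicator A y" for y
  have "mass (PL u) A = (\<integral>\<^sup>+y. f y * indicator {gl 0..gl (1/2)} y \<partial>lborel)"
    unfolding mass_def f_def by (intro nn_integral_cong) (auto simp: indicator_def PL_def)
  also have "\<dots> = (\<integral>\<^sup>+x. f (gl x) * ennreal (gl' x) * indicator {0..1/2} x \<partial>lborel)"
  proof (rule nn_integral_substitution_aux)
    show "f \<in> borel_measurable borel" unfolding f_def by measurable
    show "0 \<le> gl' x" for x using gl'_ge_1[of x] by linarith
  qed (use gl_deriv gl'_continuous in auto)
  also have "\<dots> = mass u ({..1/2} \<inter> lsv \<alpha> -` A)"
    unfolding mass_def
  proof (intro nn_integral_cong)
    fix x :: real
    show "f (gl x) * ennreal (gl' x) * indicator {0..1/2} x =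
      ennreal (u x) * indicator ({..1/2} \<inter> lsv \<alpha> -` A) x"
    proof (cases "0 < x \<and> x \<le> 1/2")
      case True
      then have "gl x \<in> {0<..1}" using lsv_range[of x] lsv_left[of x] by auto
      then have "ennreal (PL u (gl x)) * ennreal (gl' x) = ennreal (u x)"
        using True coneD(1)[OF u] gl'_ge_1[of x]
        by (auto simp: PL_def ennreal_mult[symmetric])
      then show ?thesis
        using True by (auto simp: f_def indicator_def lsv_left)
    next
      case False
      then show ?thesis
        using coneD(2)[OF u, of x] by (auto simp: f_def indicator_def PL_def)
    qed
  qed
  finally show ?thesis .
qed

lemma mass_PR:
  assumes u: "u \<in> cone" and A [measurable]: "A \<in> sets borel"
  shows "mass (PR u) A = mass u ({1/2<..} \<inter> lsv \<alpha> -` A)"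
proof -
  note [measurable] = cone_measurable[OF u] cone_measurable[OF PR_cone[OF u]]
  have [measurable]: "lsv \<alpha> -` A \<in> sets borel"
    using measurable_sets[OF lsv_measurable A] by simp
  define f where "f x = ennreal (u x) * indicator ({1/2<..} \<inter> lsv \<alpha> -` A) x" for x
  have [measurable]: "f \<in> borel_measurable borel"
    unfolding f_def by measurable
  have "mass u ({1/2<..} \<inter> lsv \<alpha> -` A) = (\<integral>\<^sup>+x. f x \<partial>lborel)"
    by (simp add: mass_def f_def)
  also have "\<dots> = ennreal \<bar>1/2\<bar> * (\<integral>\<^sup>+y. f (1/2 + 1/2 * y) \<partial>lborel)"
    by (rule nn_integral_real_affine) simp_all
  also have "\<dots> = (\<integral>\<^sup>+y. ennreal \<bar>1/2\<bar> * f (1/2 + 1/2 * y) \<partial>lborel)"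
    by (rule nn_integral_cmult[symmetric]) measurable
  also have "\<dots> = mass (PR u) A"
    unfolding mass_def
  proof (intro nn_integral_cong)
    fix y :: real
    show "ennreal \<bar>1/2\<bar> * f (1/2 + 1/2 * y) = ennreal (PR u y) * indicator A y"
    proof (cases "y \<in> {0<..1}")
      case True
      then have "lsv \<alpha> (1/2 + 1/2 * y) = y" by (simp add: lsv_right)
      moreover have "ennreal \<bar>1/2\<bar> * ennreal (u z) = ennreal (u z / 2)" for z
        using coneD(1)[OF u] by (subst ennreal_mult[symmetric]) auto
      moreover have "(1 + y) / 2 = 1/2 + 1/2 * y" by simp
      ultimately show ?thesis
        using True unfolding f_def PR_def
        by (cases "y \<in> A") (simp_all only: if_True, simp_all add: indicator_def)
    next
      case False
      then show ?thesis
        using coneD(2)[OF u, of "1/2 + 1/2 * y"] by (auto simp: f_def indicator_def PR_def)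
    qed
  qed
  finally show ?thesis by simp
qed

lemma vimage_lsv_sets [measurable, simp]: "A \<in> sets borel \<Longrightarrow> lsv \<alpha> -` A \<in> sets borel"
  using measurable_sets[OF lsv_measurable, of A] by simp

lemma vimage_funpow_lsv_sets [measurable, simp]:
  "A \<in> sets borel \<Longrightarrow> (lsv \<alpha> ^^ n) -` A \<in> sets borel"
  using measurable_sets[OF funpow_lsv_measurable, of A] by simp

lemma mass_split:
  assumes "u \<in> cone" "A \<in> sets borel" "B \<in> sets borel"
  shows "mass u (({..1/2} \<inter> lsv \<alpha> -` A) \<union> ({1/2<..} \<inter> lsv \<alpha> -` B)) = mass (PL u) A + mass (PR u) B"
  using assms by (subst mass_Un) (auto simp: mass_PL mass_PR)

section \<open>Cylinder sets\<close>

text \<open>The algebra generated by the cylinders of length \<open>n\<close>, that is, by the monotonicity intervals of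
  the \<open>n\<close>-th iterate. Recursion on the first step of the orbit avoids words and inverse branches.\<close>
fun cyl :: "nat \<Rightarrow> real set set" where
  "cyl 0 = {{}, UNIV}"
| "cyl (Suc n) = {({..1/2} \<inter> lsv \<alpha> -` V) \<union> ({1/2<..} \<inter> lsv \<alpha> -` W) |V W. V \<in> cyl n \<and> W \<in> cyl n}"

lemma cyl_sets [measurable_dest]: "V \<in> cyl n \<Longrightarrow> V \<in> sets borel"
  by (induction n arbitrary: V) auto

lemma cyl_SucI:
  "V \<in> cyl n \<Longrightarrow> W \<in> cyl n \<Longrightarrow>
    ({..1/2} \<inter> lsv \<alpha> -` V) \<union> ({1/2<..} \<inter> lsv \<alpha> -` W) \<in> cyl (Suc n)"
  unfolding cyl.simps by blast

lemma cyl_SucE: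
  assumes "V \<in> cyl (Suc n)"
  obtains A B where "V = ({..1/2} \<inter> lsv \<alpha> -` A) \<union> ({1/2<..} \<inter> lsv \<alpha> -` B)"
    "A \<in> cyl n" "B \<in> cyl n"
  using assms unfolding cyl.simps by blast

lemma cyl_Compl: "V \<in> cyl n \<Longrightarrow> - V \<in> cyl n"
proof (induction n arbitrary: V)
  case (Suc n)
  from Suc.prems obtain A B where V: "V = ({..1/2} \<inter> lsv \<alpha> -` A) \<union> ({1/2<..} \<inter> lsv \<alpha> -` B)"
    "A \<in> cyl n" "B \<in> cyl n" by (rule cyl_SucE)
  have "- V = ({..1/2} \<inter> lsv \<alpha> -` (- A)) \<union> ({1/2<..} \<inter> lsv \<alpha> -` (- B))"
    unfolding V(1) by auto
  then show ?case using cyl_SucI[OF Suc.IH[OF V(2)] Suc.IH[OF V(3)]] by (simp only:)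
qed auto

lemma cyl_Un: "V \<in> cyl n \<Longrightarrow> W \<in> cyl n \<Longrightarrow> V \<union> W \<in> cyl n"
proof (induction n arbitrary: V W)
  case (Suc n)
  from Suc.prems(1) obtain A B where V: "V = ({..1/2} \<inter> lsv \<alpha> -` A) \<union> ({1/2<..} \<inter> lsv \<alpha> -` B)"
    "A \<in> cyl n" "B \<in> cyl n" by (rule cyl_SucE)
  from Suc.prems(2) obtain C D where W: "W = ({..1/2} \<inter> lsv \<alpha> -` C) \<union> ({1/2<..} \<inter> lsv \<alpha> -` D)"
    "C \<in> cyl n" "D \<in> cyl n" by (rule cyl_SucE)
  have "V \<union> W = ({..1/2} \<inter> lsv \<alpha> -` (A \<union> C)) \<union> ({1/2<..} \<inter> lsv \<alpha> -` (B \<union> D))"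
    unfolding V(1) W(1) by auto
  then show ?case using cyl_SucI[OF Suc.IH[OF V(2) W(2)] Suc.IH[OF V(3) W(3)]] by (simp only:)
qed auto

lemma cyl_Int: "V \<inter> W \<in> cyl n" if "V \<in> cyl n" "W \<in> cyl n"
proof -
  have "- (- V \<union> - W) \<in> cyl n"
    using that by (intro cyl_Compl cyl_Un)
  then show ?thesis by simp
qed

lemma cyl_empty_UNIV: "{} \<in> cyl n \<and> UNIV \<in> cyl n"
proof (induction n)
  case (Suc n)
  have "{} = ({..1/2} \<inter> lsv \<alpha> -` {}) \<union> ({1/2<..} \<inter> lsv \<alpha> -` {})"
    "UNIV = ({..1/2} \<inter> lsv \<alpha> -` UNIV) \<union> ({1/2<..} \<inter> lsv \<alpha> -` UNIV)" by auto
  then show ?case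
    using Suc cyl_SucI[of "{}" n "{}"] cyl_SucI[of UNIV n UNIV] by (simp only: simp_thms)
qed auto

lemma cyl_Suc: "V \<in> cyl n \<Longrightarrow> V \<in> cyl (Suc n)"
proof (induction n arbitrary: V)
  case 0
  then show ?case using cyl_empty_UNIV[of 1] by auto
next
  case (Suc n)
  from Suc.prems obtain A B where V: "V = ({..1/2} \<inter> lsv \<alpha> -` A) \<union> ({1/2<..} \<inter> lsv \<alpha> -` B)"
    "A \<in> cyl n" "B \<in> cyl n" by (rule cyl_SucE)
  show ?case unfolding V(1) by (intro cyl_SucI Suc.IH V)
qed

lemma cyl_mono: "V \<in> cyl n" if "m \<le> n" "V \<in> cyl m"
  using that by (induction rule: dec_induct) (auto intro: cyl_Suc simp del: cyl.simps)

text \<open>The image under the \<open>n\<close>-th iterate of a density restricted to a union of cylinders is a sum of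
  transfers along words of length \<open>n\<close>. Each summand lies in the cone, and each step at most doubles
  the supremum, as neither branch contracts.\<close>
lemma cyl_transfer:
  assumes "V \<in> cyl n" "u \<in> cone"
  shows "\<exists>f\<in>cone. (\<forall>A\<in>sets borel. mass f A = mass u (V \<inter> (lsv \<alpha> ^^ n) -` A)) \<and>
      (\<forall>c. (\<forall>x. u x \<le> c) \<longrightarrow> (\<forall>x. f x \<le> 2 ^ n * c))"
  using assms
proof (induction n arbitrary: V u)
  case 0
  from 0(1) consider "V = {}" | "V = UNIV" unfolding cyl.simps by blast
  then show ?case
  proof cases
    case 1
    then show ?thesis
      using order_trans[OF coneD(1)[OF 0(2), of 0]]
      by (intro bexI[OF _ cone_zero] conjI ballI allI impI) (simp add: mass_def, simp)
  next
    case 2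
    then show ?thesis using 0 by (intro bexI[of _ u]) auto
  qed
next
  case (Suc n)
  from Suc.prems(1) obtain A B where V: "V = ({..1/2} \<inter> lsv \<alpha> -` A) \<union> ({1/2<..} \<inter> lsv \<alpha> -` B)"
    "A \<in> cyl n" "B \<in> cyl n" by (rule cyl_SucE)
  note u = \<open>u \<in> cone\<close>
  obtain f where f: "f \<in> cone" "\<And>E. E \<in> sets borel \<Longrightarrow> mass f E = mass (PL u) (A \<inter> (lsv \<alpha> ^^ n) -` E)"
    "\<forall>c. (\<forall>x. PL u x \<le> c) \<longrightarrow> (\<forall>x. f x \<le> 2 ^ n * c)"
    using Suc.IH[OF V(2) PL_cone[OF u]] by blast
  obtain h where h: "h \<in> cone" "\<And>E. E \<in> sets borel \<Longrightarrow> mass h E = mass (PR u) (B \<inter> (lsv \<alpha> ^^ n) -` E)"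
    "\<forall>c. (\<forall>x. PR u x \<le> c) \<longrightarrow> (\<forall>x. h x \<le> 2 ^ n * c)"
    using Suc.IH[OF V(3) PR_cone[OF u]] by blast
  note [measurable] = cyl_sets[OF V(2)] cyl_sets[OF V(3)]
  show ?case
  proof (intro bexI[of _ "\<lambda>x. f x + h x"] conjI ballI allI impI)
    show "(\<lambda>x. f x + h x) \<in> cone" using f h by (intro cone_add)
    fix E :: "real set" assume E [measurable]: "E \<in> sets borel"
    have "V \<inter> (lsv \<alpha> ^^ Suc n) -` E = ({..1/2} \<inter> lsv \<alpha> -` (A \<inter> (lsv \<alpha> ^^ n) -` E)) \<union>
        ({1/2<..} \<inter> lsv \<alpha> -` (B \<inter> (lsv \<alpha> ^^ n) -` E))"
      unfolding V funpow_Suc_right by auto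
    moreover have "mass (\<lambda>x. f x + h x) E =
        mass (PL u) (A \<inter> (lsv \<alpha> ^^ n) -` E) + mass (PR u) (B \<inter> (lsv \<alpha> ^^ n) -` E)"
      using mass_add[OF f(1) h(1) E] f(2)[OF E] h(2)[OF E] by simp
    moreover have "A \<inter> (lsv \<alpha> ^^ n) -` E \<in> sets borel" "B \<inter> (lsv \<alpha> ^^ n) -` E \<in> sets borel"
      by measurable
    ultimately show "mass (\<lambda>x. f x + h x) E = mass u (V \<inter> (lsv \<alpha> ^^ Suc n) -` E)"
      using mass_split[OF u] by (simp only:)
  next
    fix c x assume c: "\<forall>x. u x \<le> c"
    have c0: "0 \<le> c" using c coneD(1)[OF u, of 0] by (auto intro: order_trans)
    have "u y / gl' y \<le> u y / 1" for y
      using coneD(1)[OF u] gl'_ge_1[of y] by (intro divide_left_mono) auto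
    then have "u y / gl' y \<le> c" for y using c by (metis div_by_1 order_trans)
    moreover have "u y / 2 \<le> c" for y using c c0 spec[OF c, of y] by linarith
    ultimately have "PL u y \<le> c" "PR u y \<le> c" for y
      using c0 by (simp_all add: PL_def PR_def)
    then have "f x \<le> 2 ^ n * c" "h x \<le> 2 ^ n * c" using f(3) h(3) by blast+
    then show "f x + h x \<le> 2 ^ Suc n * c" by simp
  qed
qed

text \<open>Cylinders of length \<open>n\<close> have length at most \<open>\<delta> n\<close>, so endpoints of cylinders approximate every
  point from below within \<open>\<delta> n\<close>.\<close>
lemma cyl_interval:
  assumes "0 \<le> a" "a \<le> 1"
  obtains V e where "V \<in> cyl n" "V \<inter> {0<..1} = {0<..e}" "0 \<le> e" "e \<le> a" "a - e \<le> \<delta> n"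
proof -
  have "\<exists>V e. V \<in> cyl n \<and> V \<inter> {0<..1} = {0<..e} \<and> 0 \<le> e \<and> e \<le> a \<and> a - e \<le> \<delta> n"
    using assms
  proof (induction n arbitrary: a)
    case 0
    then show ?case by (intro exI[of _ "{}"] exI[of _ 0]) auto
  next
    case (Suc n)
    show ?case
    proof (cases "a \<le> 1/2")
      case True
      then have ga: "0 \<le> gl a" "gl a \<le> 1"
        using Suc.prems gl_le_iff[of a "1/2"] gl_ge[of a] by auto
      obtain V e where V: "V \<in> cyl n" "V \<inter> {0<..1} = {0<..e}" "0 \<le> e" "e \<le> gl a" "gl a - e \<le> \<delta> n"
        using Suc.IH[OF ga] by blast
      have e: "0 \<le> L e" "L e \<le> 1/2" "gl (L e) = e"
        using L[of e] V ga by auto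
      have "L e \<le> a"
        using gl_le_iff[of "L e" a] e V Suc.prems by auto
      have "gl (a - L e) \<le> gl (\<delta> (Suc n))"
        using gl_superadditive[of "a - L e" "L e"] e \<open>L e \<le> a\<close> V(5) gl_\<delta>_Suc[of n] by simp
      then have d: "a - L e \<le> \<delta> (Suc n)"
        using gl_le_iff[of "a - L e" "\<delta> (Suc n)"] \<open>L e \<le> a\<close> \<delta>_pos[of "Suc n"] by simp
      define W where "W = ({..1/2} \<inter> lsv \<alpha> -` V) \<union> ({1/2<..} \<inter> lsv \<alpha> -` {})"
      have "W \<in> cyl (Suc n)"
        unfolding W_def using V(1) cyl_empty_UNIV[of n] by (intro cyl_SucI) auto
      moreover have "W \<inter> {0<..1} = {0<..L e}"
      proof -
        have "x \<in> W \<longleftrightarrow> x \<le> L e" if x: "0 < x" "x \<le> 1/2" for x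
        proof -
          have gx: "gl x \<in> {0<..1}" using lsv_range[of x] lsv_left[of x] x by auto
          have "x \<in> W \<longleftrightarrow> gl x \<in> V \<inter> {0<..1}"
            using x gx by (auto simp: W_def lsv_left)
          also have "\<dots> \<longleftrightarrow> gl x \<le> gl (L e)"
            unfolding V(2) using gx e by auto
          also have "\<dots> \<longleftrightarrow> x \<le> L e" using gl_le_iff[of x "L e"] x e by simp
          finally show ?thesis .
        qed
        moreover have "x \<le> 1/2" if "x \<in> W" for x using that by (auto simp: W_def)
        ultimately show ?thesis using e(2) by fastforce
      qed
      ultimately show ?thesis using e(1) \<open>L e \<le> a\<close> d by blast
    next
      case False
      then have ga: "0 \<le> 2 * a - 1" "2 * a - 1 \<le> 1"
        using Suc.prems by auto
      obtain V e where V: "V \<in> cyl n" "V \<inter> {0<..1} = {0<..e}" "0 \<le> e" "e \<le> 2 * a - 1" "2 * a - 1 - e \<le> \<delta> n"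
        using Suc.IH[OF ga] by blast
      define W where "W = ({..1/2} \<inter> lsv \<alpha> -` UNIV) \<union> ({1/2<..} \<inter> lsv \<alpha> -` V)"
      have "W \<in> cyl (Suc n)"
        unfolding W_def using V(1) cyl_empty_UNIV[of n] by (intro cyl_SucI) auto
      moreover have "W \<inter> {0<..1} = {0<..(1 + e) / 2}"
      proof -
        have "x \<in> W \<longleftrightarrow> x \<le> (1 + e) / 2" if x: "1/2 < x" "x \<le> 1" for x
        proof -
          have "x \<in> W \<longleftrightarrow> 2 * x - 1 \<in> V \<inter> {0<..1}"
            using x by (auto simp: W_def lsv_right)
          also have "\<dots> \<longleftrightarrow> x \<le> (1 + e) / 2" unfolding V(2) using x by auto
          finally show ?thesis .
        qed
        moreover have "x \<in> W" if "x \<le> 1/2" for x using that by (auto simp: W_def)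
        moreover have "(1 + e) / 2 \<le> 1" using V(4) ga by simp
        ultimately show ?thesis
          using V(3) by (intro set_eqI, case_tac "x \<le> 1/2") auto
      qed
      moreover have "a - (1 + e) / 2 \<le> \<delta> (Suc n)"
        using V(5) \<delta>_half_le[of n] by (simp add: add_divide_distrib)
      moreover have "(1 + e) / 2 \<le> a" "0 \<le> (1 + e) / 2"
        using V by auto
      ultimately show ?thesis by blast
    qed
  qed
  then show thesis using that by blast
qed

text \<open>Approximation by cylinder sets in the measure of the symmetric difference.\<close>
definition cyl_approximable :: "real set \<Rightarrow> bool" where
  "cyl_approximable B \<longleftrightarrow> B \<in> sets borel \<and> (\<forall>\<epsilon>>0. \<exists>n. \<exists>V\<in>cyl n.
     emeasure lborel (((B - V) \<union> (V - B)) \<inter> {0<..1}) \<le> ennreal \<epsilon>)"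

lemma cyl_approximable_Un:
  assumes "cyl_approximable A" "cyl_approximable B"
  shows "cyl_approximable (A \<union> B)"
  unfolding cyl_approximable_def
proof (intro conjI allI impI)
  have [measurable]: "A \<in> sets borel" "B \<in> sets borel"
    using assms by (auto simp: cyl_approximable_def)
  then show "A \<union> B \<in> sets borel" by simp
  fix \<epsilon> :: real assume "0 < \<epsilon>"
  then have e: "0 < \<epsilon> / 2" by simp
  obtain m V where V: "V \<in> cyl m" "emeasure lborel (((A - V) \<union> (V - A)) \<inter> {0<..1}) \<le> ennreal (\<epsilon> / 2)"
    using assms(1) e unfolding cyl_approximable_def by blast
  obtain n W where W: "W \<in> cyl n" "emeasure lborel (((B - W) \<union> (W - B)) \<inter> {0<..1}) \<le> ennreal (\<epsilon> / 2)"
    using assms(2) e unfolding cyl_approximable_def by blast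
  note [measurable] = cyl_sets[OF V(1)] cyl_sets[OF W(1)]
  have "emeasure lborel (((A \<union> B - (V \<union> W)) \<union> (V \<union> W - (A \<union> B))) \<inter> {0<..1}) \<le>
      emeasure lborel ((((A - V) \<union> (V - A)) \<inter> {0<..1}) \<union> (((B - W) \<union> (W - B)) \<inter> {0<..1}))"
    by (intro emeasure_mono) auto
  also have "\<dots> \<le> emeasure lborel (((A - V) \<union> (V - A)) \<inter> {0<..1}) +
      emeasure lborel (((B - W) \<union> (W - B)) \<inter> {0<..1})"
    by (intro emeasure_subadditive) auto
  also have "\<dots> \<le> ennreal (\<epsilon> / 2) + ennreal (\<epsilon> / 2)"
    using V W by (intro add_mono)
  also have "\<dots> = ennreal \<epsilon>"
    using \<open>0 < \<epsilon>\<close> by (simp flip: ennreal_plus)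
  finally have "emeasure lborel (((A \<union> B - (V \<union> W)) \<union> (V \<union> W - (A \<union> B))) \<inter> {0<..1}) \<le> ennreal \<epsilon>" .
  moreover have "V \<union> W \<in> cyl (max m n)"
    using V W by (intro cyl_Un cyl_mono[of m "max m n"] cyl_mono[of n "max m n"]) auto
  ultimately show "\<exists>n. \<exists>Va\<in>cyl n. emeasure lborel ((A \<union> B - Va \<union> (Va - (A \<union> B))) \<inter> {0<..1}) \<le> ennreal \<epsilon>"
    by blast
qed

lemma cyl_approximable_atMost: "cyl_approximable {..a}"
  unfolding cyl_approximable_def
proof (intro conjI allI impI)
  fix \<epsilon> :: real assume "0 < \<epsilon>"
  then obtain n where n: "\<delta> n < \<epsilon>"
    using order_tendstoD(2)[OF \<delta>_tendsto_0] by (auto simp: eventually_sequentially)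
  obtain V e where V: "V \<in> cyl n" "V \<inter> {0<..1} = {0<..e}" "0 \<le> e" "e \<le> max 0 (min a 1)"
      "max 0 (min a 1) - e \<le> \<delta> n"
    by (rule cyl_interval[of "max 0 (min a 1)" n]) auto
  have "({..a} - V \<union> (V - {..a})) \<inter> {0<..1} \<subseteq> {e..max 0 (min a 1)}"
  proof
    fix x assume "x \<in> ({..a} - V \<union> (V - {..a})) \<inter> {0<..1}"
    moreover have "x \<in> V \<longleftrightarrow> x \<le> e" if "0 < x" "x \<le> 1"
      using V(2) that by (auto simp: set_eq_iff)
    ultimately show "x \<in> {e..max 0 (min a 1)}" using V(4) by auto
  qed
  then have "emeasure lborel (({..a} - V \<union> (V - {..a})) \<inter> {0<..1}) \<le> emeasure lborel {e..max 0 (min a 1)}"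
    by (intro emeasure_mono) auto
  also have "\<dots> \<le> ennreal \<epsilon>"
    using V n by (simp add: ennreal_leI)
  finally show "\<exists>n. \<exists>V\<in>cyl n. emeasure lborel (({..a} - V \<union> (V - {..a})) \<inter> {0<..1}) \<le> ennreal \<epsilon>"
    using V(1) by blast
qed simp

text \<open>As the cylinder sets form an increasing sequence of algebras, the approximable sets form a
  \<open>\<sigma>\<close>-algebra; it contains the half-lines by \<open>cyl_interval\<close>.\<close>
lemma cyl_approximable_borel:
  assumes "B \<in> sets borel"
  shows "cyl_approximable B"
proof -
  have "B \<in> sigma_sets UNIV (range (\<lambda>a::real. {..a}))"
    using assms by (simp add: borel_eq_atMost)
  then show ?thesis
  proof induction
    case (Basic A)
    then show ?case using cyl_approximable_atMost by auto
  next
    case Empty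
    show ?case
      using cyl_empty_UNIV by (auto simp: cyl_approximable_def intro!: exI[of _ 0])
  next
    case (Compl A)
    show ?case
      unfolding cyl_approximable_def
    proof (intro conjI allI impI)
      show "UNIV - A \<in> sets borel"
        using Compl.IH by (auto simp: cyl_approximable_def)
      fix \<epsilon> :: real assume "0 < \<epsilon>"
      then obtain n V where V: "V \<in> cyl n" "emeasure lborel (((A - V) \<union> (V - A)) \<inter> {0<..1}) \<le> ennreal \<epsilon>"
        using Compl.IH unfolding cyl_approximable_def by blast
      have "((UNIV - A) - (- V)) \<union> (- V - (UNIV - A)) = (A - V) \<union> (V - A)" by auto
      then show "\<exists>n. \<exists>V\<in>cyl n.
          emeasure lborel (((UNIV - A) - V \<union> (V - (UNIV - A))) \<inter> {0<..1}) \<le> ennreal \<epsilon>"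
        using V cyl_Compl[OF V(1)] by metis
    qed
  next
    case (Union A)
    have meas [measurable]: "A i \<in> sets borel" for i
      using Union.IH by (auto simp: cyl_approximable_def)
    have fin: "cyl_approximable (\<Union>i<k. A i)" for k
    proof (induction k)
      case 0
      then show ?case
        using cyl_empty_UNIV by (auto simp: cyl_approximable_def intro!: exI[of _ 0])
    next
      case (Suc k)
      then show ?case
        using cyl_approximable_Un[OF Suc Union.IH[of k]] by (simp add: lessThan_Suc Un_commute)
    qed
    show ?case
      unfolding cyl_approximable_def
    proof (intro conjI allI impI)
      fix \<epsilon> :: real assume "0 < \<epsilon>"
      then have e: "0 < \<epsilon> / 2" by simp
      define T where "T k = ((\<Union>i. A i) - (\<Union>i<k. A i)) \<inter> {0<..1}" for k
      have [measurable]: "T k \<in> sets borel" for k unfolding T_def by measurable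
      have "(\<lambda>k. emeasure lborel (T k)) \<longlonglongrightarrow> emeasure lborel (\<Inter>k. T k)"
      proof (rule Lim_emeasure_decseq)
        show "decseq T" by (fastforce simp: T_def decseq_def)
        have "emeasure lborel (T k) \<le> emeasure lborel {0<..1::real}" for k
          by (intro emeasure_mono) (auto simp: T_def)
        then have "emeasure lborel (T k) < top" for k
          by (rule le_less_trans) simp
        then show "emeasure lborel (T k) \<noteq> \<infinity>" for k
          by (simp add: less_top)
      qed auto
      moreover have "(\<Inter>k. T k) = {}" by (auto simp: T_def)
      ultimately have "(\<lambda>k. emeasure lborel (T k)) \<longlonglongrightarrow> 0" by simp
      then obtain k where k: "emeasure lborel (T k) < ennreal (\<epsilon> / 2)"
        using order_tendstoD(2)[of "\<lambda>k. emeasure lborel (T k)" 0 sequentially "ennreal (\<epsilon> / 2)"] e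
        by (auto simp: eventually_sequentially)
      obtain n V where V: "V \<in> cyl n"
          "emeasure lborel ((((\<Union>i<k. A i) - V) \<union> (V - (\<Union>i<k. A i))) \<inter> {0<..1}) \<le> ennreal (\<epsilon> / 2)"
        using fin[of k] e unfolding cyl_approximable_def by blast
      note [measurable] = cyl_sets[OF V(1)]
      have "emeasure lborel ((((\<Union>i. A i) - V) \<union> (V - (\<Union>i. A i))) \<inter> {0<..1}) \<le>
          emeasure lborel (((((\<Union>i<k. A i) - V) \<union> (V - (\<Union>i<k. A i))) \<inter> {0<..1}) \<union> T k)"
        by (intro emeasure_mono) (auto simp: T_def)
      also have "\<dots> \<le> emeasure lborel ((((\<Union>i<k. A i) - V) \<union> (V - (\<Union>i<k. A i))) \<inter> {0<..1}) +
          emeasure lborel (T k)"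
        by (intro emeasure_subadditive) auto
      also have "\<dots> \<le> ennreal (\<epsilon> / 2) + ennreal (\<epsilon> / 2)"
        using V k by (intro add_mono) auto
      also have "\<dots> = ennreal \<epsilon>"
        using \<open>0 < \<epsilon>\<close> by (simp flip: ennreal_plus)
      finally show "\<exists>n. \<exists>V\<in>cyl n. emeasure lborel ((((\<Union>i. A i) - V) \<union> (V - (\<Union>i. A i))) \<inter> {0<..1}) \<le> ennreal \<epsilon>"
        using V(1) by blast
    qed auto
  qed
qed

section \<open>Densities of invariant measures\<close>

definition wmass :: "(real \<Rightarrow> ennreal) \<Rightarrow> real set \<Rightarrow> ennreal" where
  "wmass \<phi> A = (\<integral>\<^sup>+x\<in>A \<inter> {0<..1}. \<phi> x \<partial>lborel)"

lemma wmass_mono: "A \<inter> {0<..1} \<subseteq> B \<Longrightarrow> wmass \<phi> A \<le> wmass \<phi> B"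
  unfolding wmass_def by (intro nn_integral_mono) (auto simp: indicator_def)

lemma wmass_mono_fun: "(\<And>x. \<phi> x \<le> \<psi> x) \<Longrightarrow> wmass \<phi> A \<le> wmass \<psi> A"
  unfolding wmass_def by (intro nn_integral_mono) (auto simp: indicator_def)

lemma wmass_Un:
  assumes [measurable]: "\<phi> \<in> borel_measurable borel" "A \<in> sets borel" "B \<in> sets borel"
    and "A \<inter> B = {}"
  shows "wmass \<phi> (A \<union> B) = wmass \<phi> A + wmass \<phi> B"
  unfolding wmass_def Int_Un_distrib2
  using assms(4) by (intro nn_integral_disjoint_pair) auto

text \<open>The measure with density \<open>\<phi>\<close>, pushed forward sufficiently often, is uniformly close to a
  measure whose density is in the cone.\<close>
definition approx_by_cone :: "(real \<Rightarrow> ennreal) \<Rightarrow> bool" where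
  "approx_by_cone \<phi> \<longleftrightarrow> (\<forall>\<epsilon>>0. \<exists>m. \<forall>n\<ge>m. \<exists>f\<in>cone. \<forall>B\<in>sets borel.
     wmass \<phi> ((lsv \<alpha> ^^ n) -` B) \<le> mass f B + ennreal \<epsilon> \<and>
     mass f B \<le> wmass \<phi> ((lsv \<alpha> ^^ n) -` B) + ennreal \<epsilon>)"

text \<open>One time \<open>m\<close> suffices: the transfer operator takes a good approximation at one time
  to an equally good one at the next.\<close>
lemma approx_by_coneI:
  assumes "\<And>\<epsilon>. 0 < \<epsilon> \<Longrightarrow> \<exists>m. \<exists>f\<in>cone. \<forall>B\<in>sets borel.
     wmass \<phi> ((lsv \<alpha> ^^ m) -` B) \<le> mass f B + ennreal \<epsilon> \<and>
     mass f B \<le> wmass \<phi> ((lsv \<alpha> ^^ m) -` B) + ennreal \<epsilon>"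
  shows "approx_by_cone \<phi>"
  unfolding approx_by_cone_def
proof (intro allI impI)
  fix \<epsilon> :: real assume "0 < \<epsilon>"
  let ?P = "\<lambda>n. \<exists>f\<in>cone. \<forall>B\<in>sets borel.
     wmass \<phi> ((lsv \<alpha> ^^ n) -` B) \<le> mass f B + ennreal \<epsilon> \<and>
     mass f B \<le> wmass \<phi> ((lsv \<alpha> ^^ n) -` B) + ennreal \<epsilon>"
  obtain m where m: "?P m" using assms[OF \<open>0 < \<epsilon>\<close>] by blast
  have "?P n" if "m \<le> n" for n
    using that
  proof (induction rule: dec_induct)
    case base
    show ?case by (rule m)
  next
    case (step n)
    obtain f where f: "f \<in> cone" "\<And>B. B \<in> sets borel \<Longrightarrow>
        wmass \<phi> ((lsv \<alpha> ^^ n) -` B) \<le> mass f B + ennreal \<epsilon> \<and>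
        mass f B \<le> wmass \<phi> ((lsv \<alpha> ^^ n) -` B) + ennreal \<epsilon>"
      using step.IH by blast
    show ?case
    proof (intro bexI ballI)
      show P: "(\<lambda>x. PL f x + PR f x) \<in> cone"
        using f PL_cone PR_cone by (intro cone_add)
      fix B :: "real set" assume B: "B \<in> sets borel"
      have "mass (\<lambda>x. PL f x + PR f x) B =
          mass f (({..1/2} \<inter> lsv \<alpha> -` B) \<union> ({1/2<..} \<inter> lsv \<alpha> -` B))"
        using f B PL_cone PR_cone by (simp only: mass_add mass_split)
      also have "({..1/2} \<inter> lsv \<alpha> -` B) \<union> ({1/2<..} \<inter> lsv \<alpha> -` B) = lsv \<alpha> -` B" by auto
      finally have "mass (\<lambda>x. PL f x + PR f x) B = mass f (lsv \<alpha> -` B)" .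
      moreover have "(lsv \<alpha> ^^ Suc n) -` B = (lsv \<alpha> ^^ n) -` (lsv \<alpha> -` B)"
        by auto
      ultimately show "wmass \<phi> ((lsv \<alpha> ^^ Suc n) -` B) \<le> mass (\<lambda>x. PL f x + PR f x) B + ennreal \<epsilon> \<and>
          mass (\<lambda>x. PL f x + PR f x) B \<le> wmass \<phi> ((lsv \<alpha> ^^ Suc n) -` B) + ennreal \<epsilon>"
        using f(2)[of "lsv \<alpha> -` B"] B by (simp only: vimage_lsv_sets)
    qed
  qed
  then show "\<exists>m. \<forall>n\<ge>m. ?P n" by blast
qed

text \<open>Replace the set by a nearby cylinder set and use \<open>cyl_transfer\<close>.\<close>
lemma approx_by_cone_indicator:
  assumes [measurable]: "A \<in> sets borel"
  shows "approx_by_cone (indicator A)"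
proof (rule approx_by_coneI)
  fix \<epsilon> :: real assume "0 < \<epsilon>"
  then obtain n V where V: "V \<in> cyl n" "emeasure lborel (((A - V) \<union> (V - A)) \<inter> {0<..1}) \<le> ennreal \<epsilon>"
    using cyl_approximable_borel[OF assms] unfolding cyl_approximable_def by blast
  note [measurable] = cyl_sets[OF V(1)]
  obtain f where f: "f \<in> cone" "\<And>B. B \<in> sets borel \<Longrightarrow>
      mass f B = mass (indicator {0<..1}) (V \<inter> (lsv \<alpha> ^^ n) -` B)"
    using cyl_transfer[OF V(1) cone_one] by blast
  have w: "wmass (indicator A) B = emeasure lborel (A \<inter> B \<inter> {0<..1})" if [measurable]: "B \<in> sets borel" for B
  proof -
    have "wmass (indicator A) B = (\<integral>\<^sup>+x. indicator (A \<inter> B \<inter> {0<..1}) x \<partial>lborel)"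
      unfolding wmass_def by (intro nn_integral_cong) (auto simp: indicator_def)
    then show ?thesis by simp
  qed
  have sub: "emeasure lborel (C \<inter> B \<inter> {0<..1}) \<le> emeasure lborel (D \<inter> B \<inter> {0<..1}) + ennreal \<epsilon>"
    if [measurable]: "B \<in> sets borel" "C \<in> sets borel" "D \<in> sets borel"
      and "C - D \<subseteq> (A - V) \<union> (V - A)" for B C D
  proof -
    have "emeasure lborel (C \<inter> B \<inter> {0<..1}) \<le>
        emeasure lborel ((D \<inter> B \<inter> {0<..1}) \<union> (((A - V) \<union> (V - A)) \<inter> {0<..1}))"
      using that(4) by (intro emeasure_mono) auto
    also have "\<dots> \<le> emeasure lborel (D \<inter> B \<inter> {0<..1}) + emeasure lborel (((A - V) \<union> (V - A)) \<inter> {0<..1})"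
      by (intro emeasure_subadditive) auto
    finally show ?thesis using V(2) by (meson add_left_mono order_trans)
  qed
  show "\<exists>m. \<exists>f\<in>cone. \<forall>B\<in>sets borel.
     wmass (indicator A) ((lsv \<alpha> ^^ m) -` B) \<le> mass f B + ennreal \<epsilon> \<and>
     mass f B \<le> wmass (indicator A) ((lsv \<alpha> ^^ m) -` B) + ennreal \<epsilon>"
  proof (intro exI[of _ n] bexI[OF _ f(1)] ballI conjI)
    fix B :: "real set" assume B [measurable]: "B \<in> sets borel"
    have m: "mass f B = emeasure lborel (V \<inter> (lsv \<alpha> ^^ n) -` B \<inter> {0<..1})"
      using f(2)[OF B] by (simp add: mass_one)
    show "wmass (indicator A) ((lsv \<alpha> ^^ n) -` B) \<le> mass f B + ennreal \<epsilon>"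
      unfolding m w[OF vimage_funpow_lsv_sets[OF B]] by (intro sub) auto
    show "mass f B \<le> wmass (indicator A) ((lsv \<alpha> ^^ n) -` B) + ennreal \<epsilon>"
      unfolding m w[OF vimage_funpow_lsv_sets[OF B]] by (intro sub) auto
  qed
qed

text \<open>The property is stable under nonnegative linear combinations, because the cone is convex, and under
  increasing limits of finite mass, because an error in \<open>L\<^sup>1\<close> does not grow when pushed forward.\<close>
lemma approx_by_cone_integrable:
  assumes "\<phi> \<in> borel_measurable borel" "wmass \<phi> UNIV < \<infinity>"
  shows "approx_by_cone \<phi>"
  using assms
proof (induction rule: borel_measurable_induct)
  case (cong f g)
  then have "f = g" by (intro ext) simp
  with cong show ?case by simp
next
  case (set A)
  then show ?case using approx_by_cone_indicator by simp
next
  case (mult u c)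
  note [measurable] = \<open>u \<in> borel_measurable borel\<close>
  have wc: "wmass (\<lambda>x. c * u x) B = c * wmass u B" if [measurable]: "B \<in> sets borel" for B
    unfolding wmass_def by (subst nn_integral_cmult[symmetric]) (auto intro!: nn_integral_cong simp: mult.assoc)
  show ?case
  proof (cases "c = 0")
    case True
    then show ?thesis
      using cone_zero by (intro approx_by_coneI exI[of _ 0] bexI[OF _ cone_zero]) (simp add: wmass_def)
  next
    case False
    then obtain r where r: "c = ennreal r" "0 < r"
      using \<open>c < top\<close> by (cases c) (auto simp: less_le)
    have "wmass u UNIV < \<infinity>"
      using mult.prems False wc[of UNIV] by (auto simp: ennreal_mult_less_top)
    then have u: "approx_by_cone u" using mult.IH by simp
    show ?thesis
    proof (rule approx_by_coneI)
      fix \<epsilon> :: real assume "0 < \<epsilon>"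
      then have e: "0 < \<epsilon> / r" using r by simp
      obtain m where m: "\<And>n. n \<ge> m \<Longrightarrow> \<exists>f\<in>cone. \<forall>B\<in>sets borel.
         wmass u ((lsv \<alpha> ^^ n) -` B) \<le> mass f B + ennreal (\<epsilon> / r) \<and>
         mass f B \<le> wmass u ((lsv \<alpha> ^^ n) -` B) + ennreal (\<epsilon> / r)"
        using u e unfolding approx_by_cone_def by blast
      obtain f where f: "f \<in> cone" "\<And>B. B \<in> sets borel \<Longrightarrow>
         wmass u ((lsv \<alpha> ^^ m) -` B) \<le> mass f B + ennreal (\<epsilon> / r)"
         "\<And>B. B \<in> sets borel \<Longrightarrow> mass f B \<le> wmass u ((lsv \<alpha> ^^ m) -` B) + ennreal (\<epsilon> / r)"
        using m[of m] by blast
      have ce: "c * (x + ennreal (\<epsilon> / r)) = c * x + ennreal \<epsilon>" for x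
        using r \<open>0 < \<epsilon>\<close> by (simp add: distrib_left ennreal_mult[symmetric])
      have rf: "(\<lambda>x. r * f x) \<in> cone" using f r by (intro cone_scale) auto
      show "\<exists>m. \<exists>f\<in>cone. \<forall>B\<in>sets borel.
         wmass (\<lambda>x. c * u x) ((lsv \<alpha> ^^ m) -` B) \<le> mass f B + ennreal \<epsilon> \<and>
         mass f B \<le> wmass (\<lambda>x. c * u x) ((lsv \<alpha> ^^ m) -` B) + ennreal \<epsilon>"
      proof (intro exI[of _ m] bexI[OF _ rf] ballI)
        fix B :: "real set" assume B: "B \<in> sets borel"
        have "mass (\<lambda>x. r * f x) B = c * mass f B" using mass_scale[OF f(1) B, of r] r by simp
        then show "wmass (\<lambda>x. c * u x) ((lsv \<alpha> ^^ m) -` B) \<le> mass (\<lambda>x. r * f x) B + ennreal \<epsilon> \<and>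
         mass (\<lambda>x. r * f x) B \<le> wmass (\<lambda>x. c * u x) ((lsv \<alpha> ^^ m) -` B) + ennreal \<epsilon>"
          using mult_left_mono[OF f(2)[OF B], of c] mult_left_mono[OF f(3)[OF B], of c]
          unfolding ce wc[OF vimage_funpow_lsv_sets[OF B]] by simp
      qed
    qed
  qed
next
  case (add u v)
  note [measurable] = \<open>u \<in> borel_measurable borel\<close> \<open>v \<in> borel_measurable borel\<close>
  have wa: "wmass (\<lambda>x. v x + u x) B = wmass v B + wmass u B" if [measurable]: "B \<in> sets borel" for B
    unfolding wmass_def
    by (subst nn_integral_add[symmetric]) (auto intro!: nn_integral_cong simp: distrib_right)
  have "wmass u UNIV < \<infinity>" "wmass v UNIV < \<infinity>"
    using add.prems wa[of UNIV] by auto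
  then have uv: "approx_by_cone u" "approx_by_cone v" using add.IH by auto
  show ?case
  proof (rule approx_by_coneI)
    fix \<epsilon> :: real assume "0 < \<epsilon>"
    then have e: "0 < \<epsilon> / 2" by simp
    obtain m where m: "\<And>n. n \<ge> m \<Longrightarrow> \<exists>f\<in>cone. \<forall>B\<in>sets borel.
       wmass u ((lsv \<alpha> ^^ n) -` B) \<le> mass f B + ennreal (\<epsilon> / 2) \<and>
       mass f B \<le> wmass u ((lsv \<alpha> ^^ n) -` B) + ennreal (\<epsilon> / 2)"
      using uv(1) e unfolding approx_by_cone_def by blast
    obtain k where k: "\<And>n. n \<ge> k \<Longrightarrow> \<exists>f\<in>cone. \<forall>B\<in>sets borel.
       wmass v ((lsv \<alpha> ^^ n) -` B) \<le> mass f B + ennreal (\<epsilon> / 2) \<and>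
       mass f B \<le> wmass v ((lsv \<alpha> ^^ n) -` B) + ennreal (\<epsilon> / 2)"
      using uv(2) e unfolding approx_by_cone_def by blast
    let ?n = "max m k"
    obtain f where f: "f \<in> cone" "\<And>B. B \<in> sets borel \<Longrightarrow>
       wmass u ((lsv \<alpha> ^^ ?n) -` B) \<le> mass f B + ennreal (\<epsilon> / 2)"
       "\<And>B. B \<in> sets borel \<Longrightarrow> mass f B \<le> wmass u ((lsv \<alpha> ^^ ?n) -` B) + ennreal (\<epsilon> / 2)"
      using m[of ?n] by (meson max.cobounded1)
    obtain h where h: "h \<in> cone" "\<And>B. B \<in> sets borel \<Longrightarrow>
       wmass v ((lsv \<alpha> ^^ ?n) -` B) \<le> mass h B + ennreal (\<epsilon> / 2)"
       "\<And>B. B \<in> sets borel \<Longrightarrow> mass h B \<le> wmass v ((lsv \<alpha> ^^ ?n) -` B) + ennreal (\<epsilon> / 2)"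
      using k[of ?n] by (meson max.cobounded2)
    have ee: "ennreal \<epsilon> = ennreal (\<epsilon> / 2) + ennreal (\<epsilon> / 2)"
      using e by (subst ennreal_plus[symmetric]) auto
    have sum: "(\<lambda>x. h x + f x) \<in> cone" using f h by (intro cone_add)
    show "\<exists>m. \<exists>f\<in>cone. \<forall>B\<in>sets borel.
       wmass (\<lambda>x. v x + u x) ((lsv \<alpha> ^^ m) -` B) \<le> mass f B + ennreal \<epsilon> \<and>
       mass f B \<le> wmass (\<lambda>x. v x + u x) ((lsv \<alpha> ^^ m) -` B) + ennreal \<epsilon>"
    proof (intro exI[of _ ?n] bexI[OF _ sum] ballI)
      fix B :: "real set" assume B: "B \<in> sets borel"
      show "wmass (\<lambda>x. v x + u x) ((lsv \<alpha> ^^ ?n) -` B) \<le> mass (\<lambda>x. h x + f x) B + ennreal \<epsilon> \<and>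
         mass (\<lambda>x. h x + f x) B \<le> wmass (\<lambda>x. v x + u x) ((lsv \<alpha> ^^ ?n) -` B) + ennreal \<epsilon>"
        using add_mono[OF h(2)[OF B] f(2)[OF B]] add_mono[OF h(3)[OF B] f(3)[OF B]]
        unfolding wa[OF vimage_funpow_lsv_sets[OF B]] mass_add[OF h(1) f(1) B] ee
        by (simp add: add_ac)
    qed
  qed
next
  case (seq U)
  note [measurable] = \<open>\<And>i. U i \<in> borel_measurable borel\<close>
  define \<phi> where "\<phi> = (SUP i. U i)"
  have [measurable]: "\<phi> \<in> borel_measurable borel" unfolding \<phi>_def SUP_apply by measurable
  have le: "U i x \<le> \<phi> x" for i x
    by (auto simp: \<phi>_def intro: SUP_upper le_funD)
  have fin: "wmass \<phi> UNIV < \<infinity>" unfolding \<phi>_def by (rule seq.prems)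
  have finB: "wmass \<phi> B < \<infinity>" for B
    using wmass_mono[of B UNIV \<phi>] fin by (auto intro: le_less_trans)
  have U: "approx_by_cone (U i)" for i
    using seq.IH[of i] wmass_mono_fun[of "U i" \<phi> UNIV] le fin by (auto intro: le_less_trans)
  have "wmass \<phi> UNIV = (\<integral>\<^sup>+x. (SUP i. U i x * indicator {0<..1} x) \<partial>lborel)"
    unfolding wmass_def \<phi>_def
    by (intro nn_integral_cong) (auto simp: SUP_apply SUP_mult_right_ennreal image_comp)
  also have "\<dots> = (SUP i. wmass (U i) UNIV)"
    unfolding wmass_def using \<open>incseq U\<close>
    by (subst nn_integral_monotone_convergence_SUP)
       (auto simp: incseq_def le_fun_def intro!: mult_right_mono)
  finally have sup: "wmass \<phi> UNIV = (SUP i. wmass (U i) UNIV)" .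
  show ?case unfolding \<phi>_def[symmetric]
  proof (rule approx_by_coneI)
    fix \<epsilon> :: real assume "0 < \<epsilon>"
    then have e: "0 < \<epsilon> / 2" by simp
    have "\<exists>i. wmass \<phi> UNIV \<le> wmass (U i) UNIV + ennreal (\<epsilon> / 2)"
    proof (cases "wmass \<phi> UNIV = 0")
      case False
      define a where "a = wmass \<phi> UNIV - ennreal (\<epsilon> / 2)"
      have "a < wmass \<phi> UNIV"
        unfolding a_def using fin e False by (intro ennreal_between) (auto simp: zero_less_iff_neq_zero)
      then obtain i where "a < wmass (U i) UNIV"
        unfolding sup less_SUP_iff by blast
      then have "a \<le> wmass (U i) UNIV" by simp
      then show ?thesis
        unfolding a_def ennreal_minus_le_iff by (intro exI[of _ i]) (simp add: add.commute)
    qed simp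
    then obtain i where i: "wmass \<phi> UNIV \<le> wmass (U i) UNIV + ennreal (\<epsilon> / 2)" by blast
    have close: "wmass \<phi> B \<le> wmass (U i) B + ennreal (\<epsilon> / 2)" if [measurable]: "B \<in> sets borel" for B
    proof -
      have "wmass \<phi> B + wmass \<phi> (- B) = wmass \<phi> UNIV"
        by (subst wmass_Un[symmetric]) auto
      also have "\<dots> \<le> wmass (U i) UNIV + ennreal (\<epsilon> / 2)" by (rule i)
      also have "wmass (U i) UNIV = wmass (U i) B + wmass (U i) (- B)"
        by (subst wmass_Un[symmetric]) auto
      also have "\<dots> + ennreal (\<epsilon> / 2) \<le> wmass (U i) B + wmass \<phi> (- B) + ennreal (\<epsilon> / 2)"
        by (intro add_mono wmass_mono_fun le order_refl)
      finally have "wmass \<phi> (- B) + wmass \<phi> B \<le> wmass \<phi> (- B) + (wmass (U i) B + ennreal (\<epsilon> / 2))"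
        by (simp add: add_ac)
      then show ?thesis
        using finB[of "- B"] by (auto simp: ennreal_add_left_cancel_le)
    qed
    obtain m where m: "\<And>n. n \<ge> m \<Longrightarrow> \<exists>f\<in>cone. \<forall>B\<in>sets borel.
       wmass (U i) ((lsv \<alpha> ^^ n) -` B) \<le> mass f B + ennreal (\<epsilon> / 2) \<and>
       mass f B \<le> wmass (U i) ((lsv \<alpha> ^^ n) -` B) + ennreal (\<epsilon> / 2)"
      using U[of i] e unfolding approx_by_cone_def by blast
    obtain f where f: "f \<in> cone" "\<And>B. B \<in> sets borel \<Longrightarrow>
       wmass (U i) ((lsv \<alpha> ^^ m) -` B) \<le> mass f B + ennreal (\<epsilon> / 2)"
       "\<And>B. B \<in> sets borel \<Longrightarrow> mass f B \<le> wmass (U i) ((lsv \<alpha> ^^ m) -` B) + ennreal (\<epsilon> / 2)"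
      using m[of m] by blast
    have ee: "ennreal \<epsilon> = ennreal (\<epsilon> / 2) + ennreal (\<epsilon> / 2)"
      using e by (subst ennreal_plus[symmetric]) auto
    show "\<exists>m. \<exists>f\<in>cone. \<forall>B\<in>sets borel.
       wmass \<phi> ((lsv \<alpha> ^^ m) -` B) \<le> mass f B + ennreal \<epsilon> \<and>
       mass f B \<le> wmass \<phi> ((lsv \<alpha> ^^ m) -` B) + ennreal \<epsilon>"
    proof (intro exI[of _ m] bexI[OF _ f(1)] ballI conjI)
      fix B :: "real set" assume B: "B \<in> sets borel"
      let ?B = "(lsv \<alpha> ^^ m) -` B"
      have "wmass \<phi> ?B \<le> wmass (U i) ?B + ennreal (\<epsilon> / 2)"
        using B by (intro close) simp
      also have "\<dots> \<le> mass f B + ennreal (\<epsilon> / 2) + ennreal (\<epsilon> / 2)"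
        using f(2)[OF B] by (intro add_right_mono)
      finally show "wmass \<phi> ?B \<le> mass f B + ennreal \<epsilon>" unfolding ee by (simp add: add_ac)
      have "mass f B \<le> wmass (U i) ?B + ennreal (\<epsilon> / 2)" by (rule f(3)[OF B])
      also have "\<dots> \<le> wmass \<phi> ?B + ennreal \<epsilon>"
        using e by (intro add_mono wmass_mono_fun le ennreal_leI) auto
      finally show "mass f B \<le> wmass \<phi> ?B + ennreal \<epsilon>" .
    qed
  qed
qed

text \<open>An invariant measure equals its own push-forwards, so it is itself close to measures with
  density in the cone and inherits their distortion bound.\<close>
lemma invariant_density_comparable:
  assumes \<phi>: "\<phi> \<in> borel_measurable borel" "wmass \<phi> UNIV < \<infinity>"
    and inv: "\<And>B. B \<in> sets borel \<Longrightarrow> wmass \<phi> (lsv \<alpha> -` B) = wmass \<phi> B"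
    and A: "A \<in> sets borel" "A \<subseteq> {1/2<..1}" and B: "B \<in> sets borel" "B \<subseteq> {1/2<..1}"
  shows "emeasure lborel B * wmass \<phi> A \<le> 4 * emeasure lborel A * wmass \<phi> B"
proof (rule ennreal_le_epsilon)
  have inv_n: "wmass \<phi> ((lsv \<alpha> ^^ n) -` E) = wmass \<phi> E" if "E \<in> sets borel" for n E
    using that
  proof (induction n arbitrary: E)
    case (Suc n)
    have "(lsv \<alpha> ^^ Suc n) -` E = (lsv \<alpha> ^^ n) -` (lsv \<alpha> -` E)" by auto
    then show ?case using Suc.IH[of "lsv \<alpha> -` E"] inv Suc.prems by (simp only: vimage_lsv_sets)
  qed simp
  have le1: "emeasure lborel E \<le> 1" if "E \<subseteq> {1/2<..1}" for E :: "real set"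
  proof -
    have "emeasure lborel E \<le> emeasure lborel {0..1::real}"
      using that by (intro emeasure_mono) auto
    then show ?thesis by simp
  qed
  fix e :: real assume "0 < e"
  then have e: "0 < e / 5" by simp
  obtain n where n: "\<And>m. m \<ge> n \<Longrightarrow> \<exists>f\<in>cone. \<forall>B\<in>sets borel.
       wmass \<phi> ((lsv \<alpha> ^^ m) -` B) \<le> mass f B + ennreal (e / 5) \<and>
       mass f B \<le> wmass \<phi> ((lsv \<alpha> ^^ m) -` B) + ennreal (e / 5)"
    using approx_by_cone_integrable[OF \<phi>] e unfolding approx_by_cone_def by blast
  obtain f where f: "f \<in> cone" "\<And>B. B \<in> sets borel \<Longrightarrow> wmass \<phi> B \<le> mass f B + ennreal (e / 5)"
      "\<And>B. B \<in> sets borel \<Longrightarrow> mass f B \<le> wmass \<phi> B + ennreal (e / 5)"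
    using n[of n] inv_n by (metis order_refl)
  have "emeasure lborel B * wmass \<phi> A \<le> emeasure lborel B * mass f A + emeasure lborel B * ennreal (e / 5)"
    unfolding distrib_left[symmetric] using f(2)[OF A(1)] by (intro mult_left_mono) auto
  also have "\<dots> \<le> 4 * emeasure lborel A * mass f B + 1 * ennreal (e / 5)"
    using cone_distortion[OF f(1) A B] le1[OF B(2)] by (intro add_mono mult_right_mono) auto
  also have "4 * emeasure lborel A * mass f B \<le> 4 * emeasure lborel A * (wmass \<phi> B + ennreal (e / 5))"
    using f(3)[OF B(1)] by (intro mult_left_mono) auto
  also have "\<dots> \<le> 4 * emeasure lborel A * wmass \<phi> B + 4 * 1 * ennreal (e / 5)"
    unfolding distrib_left using le1[OF A(2)] by (intro add_left_mono mult_right_mono mult_left_mono) auto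
  also have "\<dots> + 1 * ennreal (e / 5) = 4 * emeasure lborel A * wmass \<phi> B + ennreal e"
  proof -
    have "4 * 1 * ennreal (e / 5) + 1 * ennreal (e / 5) = ennreal (4 * (e / 5)) + ennreal (e / 5)"
      using e ennreal_mult[of 4 "e / 5"] by simp
    also have "\<dots> = ennreal e" using e by (subst ennreal_plus[symmetric]) auto
    finally show ?thesis by (simp add: add.assoc)
  qed
  finally show "emeasure lborel B * wmass \<phi> A \<le> 4 * emeasure lborel A * wmass \<phi> B + ennreal e"
    by (simp add: add_right_mono)
qed

end

section \<open>Lebesgue measure of the points avoiding a cylinder set\<close>

text \<open>Read \<open>P a n\<close> as: a certain quantity is at most \<open>a\<close> at time \<open>n\<close>. To reach time \<open>n\<close> one
  waits \<open>m\<close>, a small proportion \<open>\<eta>\<close> of \<open>n\<close>. The waiting costs \<open>D * d m\<close>, which has the right order, while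
  the contribution of the remaining time is contracted by \<open>\<rho>\<close>; passing from time \<open>n\<close> to
  \<open>(1 - 2 * \<eta>) * n\<close> loses only a constant factor close to \<open>1\<close>, so the contraction wins.\<close>
lemma polynomial_decay_recursion:
  fixes P :: "real \<Rightarrow> nat \<Rightarrow> bool" and d :: "nat \<Rightarrow> real"
  assumes P_mono: "\<And>a b n. P a n \<Longrightarrow> a \<le> b \<Longrightarrow> P b n"
    and P_1: "\<And>n. P 1 n"
    and P_step: "\<And>a j m. 0 \<le> a \<Longrightarrow> P a j \<Longrightarrow> P (D * d m + \<rho> * a) (N + m + j)"
    and d: "\<And>m. 1 \<le> m \<Longrightarrow> d m \<le> C * real m powr - \<beta>"
    and const: "0 \<le> D" "0 \<le> C" "0 \<le> \<rho>" "\<rho> < 1" "0 < \<beta>"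
  obtains A where "0 < A" "\<And>n. 1 \<le> n \<Longrightarrow> P (A * real n powr - \<beta>) n"
proof -
  define r where "r = (1 + \<rho>) / 2"
  have r: "\<rho> < r" "r < 1" "0 < r" using const by (auto simp: r_def)
  have "((\<lambda>\<eta>. \<rho> * (1 - 2 * \<eta>) powr - \<beta>) \<longlongrightarrow> \<rho> * (1 - 2 * 0) powr - \<beta>) (at_right 0)"
    by (intro tendsto_intros) auto
  then have "\<forall>\<^sub>F \<eta> in at_right 0. \<rho> * (1 - 2 * \<eta>) powr - \<beta> < r"
    using r by (intro order_tendstoD(2)) auto
  moreover have "\<forall>\<^sub>F \<eta> in at_right 0. \<eta> < (1/4::real)"
    by (rule eventually_at_right_real[THEN eventually_mono, of 0 "1/4"]) auto
  moreover have "\<forall>\<^sub>F \<eta> in at_right 0. 0 < (\<eta>::real)"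
    by (rule eventually_at_right_less)
  ultimately have "\<forall>\<^sub>F \<eta> in at_right 0. \<rho> * (1 - 2 * \<eta>) powr - \<beta> < r \<and> \<eta> < 1/4 \<and> 0 < \<eta>"
    by eventually_elim auto
  then obtain \<eta> where \<eta>: "\<rho> * (1 - 2 * \<eta>) powr - \<beta> < r" "\<eta> < 1/4" "0 < \<eta>"
    using eventually_happens'[of "at_right (0::real)"] by (auto simp: trivial_limit_at_right_real)
  \<comment> \<open>Beyond \<open>n0\<close> the fixed delay \<open>N\<close> is below \<open>\<eta> * n\<close>, and rounding \<open>\<eta> * n\<close> down loses at most
    half of it. The first argument of the maximum covers the times up to \<open>n0\<close>, where the trivial
    bound \<open>P 1 n\<close> is used.\<close>
  define n0 where "n0 = (real N + 2) / \<eta>"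
  define A where "A = max (n0 powr \<beta>) (D * C * (\<eta> / 2) powr - \<beta> / (1 - r))"
  have n0: "0 < n0" using \<eta> by (simp add: n0_def)
  have A: "0 < A" "n0 powr \<beta> \<le> A" "D * C * (\<eta> / 2) powr - \<beta> \<le> A * (1 - r)"
  proof -
    show "n0 powr \<beta> \<le> A" by (simp add: A_def)
    then show "0 < A" by (rule less_le_trans[rotated]) (use n0 in simp)
    have "D * C * (\<eta> / 2) powr - \<beta> / (1 - r) \<le> A" by (simp add: A_def)
    then show "D * C * (\<eta> / 2) powr - \<beta> \<le> A * (1 - r)" using r by (simp add: pos_divide_le_eq)
  qed
  have "P (A * real n powr - \<beta>) n" if "1 \<le> n" for n
    using that
  proof (induction n rule: less_induct)
    case (less n)
    show ?case
    proof (cases "real n < n0")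
      case True
      have "real n powr \<beta> \<le> n0 powr \<beta>"
        using True const less.prems by (intro powr_mono2) auto
      then have "1 \<le> A * real n powr - \<beta>"
        using A less.prems by (simp add: powr_minus field_simps)
      then show ?thesis using P_mono[OF P_1] by blast
    next
      case False
      then have nN: "real N + 2 \<le> \<eta> * real n"
        using \<eta> by (simp add: n0_def field_simps)
      define m where "m = nat \<lfloor>\<eta> * real n\<rfloor>"
      have m: "real m \<le> \<eta> * real n" "\<eta> * real n - 1 < real m"
        using nN by (auto simp: m_def of_nat_floor) 
      then have m2: "\<eta> * real n / 2 \<le> real m" "1 \<le> m" using nN by auto
      have half: "\<eta> * real n \<le> real n / 4" using \<eta> mult_right_mono[of \<eta> "1/4" "real n"] by simp
      define j where "j = n - N - m"
      have "real N + real m \<le> real n" using m nN half by linarith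
      then have n: "n = N + m + j" and "real j = real n - real N - real m"
        by (auto simp: j_def)
      then have j: "(1 - 2 * \<eta>) * real n \<le> real j" using m nN by (simp add: algebra_simps)
      have j_pos: "0 < (1 - 2 * \<eta>) * real n" using \<eta> less.prems by simp
      have "1 \<le> j" "j < n" using j j_pos n m2 by auto
      then have "P (A * real j powr - \<beta>) j" by (intro less.IH)
      then have "P (D * d m + \<rho> * (A * real j powr - \<beta>)) (N + m + j)"
        using A by (intro P_step) auto
      moreover have "D * d m + \<rho> * (A * real j powr - \<beta>) \<le> A * real n powr - \<beta>"
      proof -
        have "d m \<le> C * real m powr - \<beta>" using d m2 by simp
        also have "\<dots> \<le> C * (\<eta> * real n / 2) powr - \<beta>"
          using m2 const \<eta> less.prems by (intro mult_left_mono powr_mono2') auto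
        also have "(\<eta> * real n / 2) powr - \<beta> = (\<eta> / 2) powr - \<beta> * real n powr - \<beta>"
          using \<eta> by (simp add: powr_mult[symmetric])
        finally have "D * d m \<le> D * (C * ((\<eta> / 2) powr - \<beta> * real n powr - \<beta>))"
          using const by (intro mult_left_mono) auto
        also have "\<dots> = D * C * (\<eta> / 2) powr - \<beta> * real n powr - \<beta>" by simp
        also have "\<dots> \<le> A * (1 - r) * real n powr - \<beta>"
          using A by (intro mult_right_mono) auto
        finally have 1: "D * d m \<le> A * (1 - r) * real n powr - \<beta>" .
        have "\<rho> * (A * real j powr - \<beta>) \<le> \<rho> * (A * ((1 - 2 * \<eta>) * real n) powr - \<beta>)"
          using const A j j_pos by (intro mult_left_mono powr_mono2') auto
        also have "\<dots> = A * (\<rho> * (1 - 2 * \<eta>) powr - \<beta>) * real n powr - \<beta>"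
          using \<eta> by (simp add: powr_mult)
        also have "\<dots> \<le> A * r * real n powr - \<beta>"
          using \<eta> A by (intro mult_right_mono mult_left_mono) auto
        finally have 2: "\<rho> * (A * real j powr - \<beta>) \<le> A * r * real n powr - \<beta>" .
        show ?thesis using add_mono[OF 1 2] by (simp add: algebra_simps)
      qed
      ultimately show ?thesis unfolding n[symmetric] by (rule P_mono)
    qed
  qed
  with A(1) show thesis using that by blast
qed

context lsv_map
begin

text \<open>The points that avoid \<open>K\<close> up to time \<open>n\<close>, the initial time included.\<close>
definition surv :: "real set \<Rightarrow> nat \<Rightarrow> real set" where
  "surv K n = {x. \<forall>k\<le>n. (lsv \<alpha> ^^ k) x \<notin> K}"

lemma surv_Suc: "surv K (Suc n) = - K \<inter> lsv \<alpha> -` surv K n"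
proof -
  have "{..Suc n} = insert 0 (Suc ` {..n})"
    by (rule atMost_Suc_eq_insert_0)
  then have "(\<forall>k\<in>{..Suc n}. (lsv \<alpha> ^^ k) x \<notin> K) \<longleftrightarrow>
      x \<notin> K \<and> (\<forall>k\<in>{..n}. (lsv \<alpha> ^^ k) (lsv \<alpha> x) \<notin> K)" for x
    by (simp add: funpow_Suc_right del: funpow.simps(2))
  then show ?thesis by (auto simp: surv_def)
qed

lemma surv_antimono: "m \<le> n \<Longrightarrow> surv K n \<subseteq> surv K m"
  by (auto simp: surv_def)

lemma surv_sets [measurable, simp]: "surv K n \<in> sets borel" if [measurable]: "K \<in> sets borel"
proof -
  have "surv K n = (\<Inter>k\<in>{..n}. (lsv \<alpha> ^^ k) -` (- K))"
    by (auto simp: surv_def)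
  also have "\<dots> \<in> sets borel" by measurable
  finally show ?thesis .
qed

lemma surv_subset_vimage: "surv K (N + n) \<subseteq> - K \<inter> (lsv \<alpha> ^^ N) -` surv K n"
proof
  fix x assume x: "x \<in> surv K (N + n)"
  have "(lsv \<alpha> ^^ k) ((lsv \<alpha> ^^ N) x) \<notin> K" if "k \<le> n" for k
    using x that by (auto simp: surv_def funpow_add[THEN fun_cong, unfolded comp_def, symmetric])
  moreover have "(lsv \<alpha> ^^ 0) x \<notin> K" using x unfolding surv_def by blast
  ultimately show "x \<in> - K \<inter> (lsv \<alpha> ^^ N) -` surv K n" by (auto simp: surv_def)
qed

lemma lsv_vimage_split: "lsv \<alpha> -` A = ({..1/2} \<inter> lsv \<alpha> -` A) \<union> ({1/2<..} \<inter> lsv \<alpha> -` A)"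
  by auto

lemma vimage_\<delta>: "({..1/2} \<inter> lsv \<alpha> -` {..\<delta> n}) \<inter> {0<..1} = {..\<delta> (Suc n)} \<inter> {0<..1}"
proof -
  have "lsv \<alpha> x \<le> \<delta> n \<longleftrightarrow> x \<le> \<delta> (Suc n)" if "0 < x" "x \<le> 1/2" for x
    using that gl_le_iff[of x "\<delta> (Suc n)"] gl_\<delta>_Suc[of n] \<delta>_pos[of "Suc n"] by (simp add: lsv_left)
  then show ?thesis using \<delta>_Suc_le_half[of n] by auto
qed

text \<open>Decompose according to the first visit to the right branch. If it has not
  happened within \<open>m\<close> steps, the point started in \<open>{..\<delta> m}\<close>; if it has, the density right after it is
  flat and at least \<open>j\<close> steps remain, so the assumed bound applies.\<close>
lemma mass_surv_return:
  assumes K: "K \<in> sets borel"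
    and a: "\<And>v. v \<in> flat_cone \<Longrightarrow> mass v (surv K j) \<le> a * mass v UNIV"
    and f: "f \<in> cone" and n: "m + j \<le> n"
  shows "mass f (surv K n) \<le> mass f {..\<delta> m} + a * mass f UNIV"
  using f n
proof (induction m arbitrary: f n)
  case 0
  then have "mass f (surv K n) \<le> mass f {..\<delta> 0}" by (intro mass_mono) auto
  then show ?case by (rule order_trans) simp
next
  case (Suc m)
  then obtain k where k: "n = Suc k" "m + j \<le> k" by (cases n) auto
  note f = \<open>f \<in> cone\<close>
  have "mass f (surv K n) \<le> mass f (lsv \<alpha> -` surv K k)"
    unfolding k surv_Suc using f by (intro mass_mono) auto
  also have "\<dots> = mass (PL f) (surv K k) + mass (PR f) (surv K k)"
    using f K by (subst lsv_vimage_split, subst mass_split) auto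
  also have "mass (PL f) (surv K k) \<le> mass (PL f) {..\<delta> m} + a * mass (PL f) UNIV"
    using f k by (intro Suc.IH PL_cone)
  also have "mass (PL f) {..\<delta> m} = mass f {..\<delta> (Suc m)}"
    using mass_PL[OF f, of "{..\<delta> m}"] mass_cong[OF vimage_\<delta> f, of m] by simp
  also have "mass (PR f) (surv K k) \<le> mass (PR f) (surv K j)"
    using surv_antimono[of j k K] k f by (intro mass_mono PR_cone) auto
  also have "\<dots> \<le> a * mass (PR f) UNIV"
    using f by (intro a PR_flat_cone)
  also have "mass f {..\<delta> (Suc m)} + a * mass (PL f) UNIV + a * mass (PR f) UNIV =
      mass f {..\<delta> (Suc m)} + a * mass f UNIV"
    using mass_split[OF f, of UNIV UNIV] lsv_vimage_split[of UNIV]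
    by (simp add: add.assoc distrib_left[symmetric])
  finally show ?case by (simp add: add_mono)
qed

text \<open>In the first \<open>N\<close> steps a flat density loses to \<open>K\<close> at least the proportion \<open>\<kappa> / 4\<close> of its mass. The
  rest has a bounded density in the cone, so its mass in \<open>{..\<delta> m}\<close> is of order \<open>\<delta> m\<close>, and
  \<open>mass_surv_return\<close> applies.\<close>
lemma mass_surv_step:
  assumes K: "K \<in> cyl N" and \<kappa>: "ennreal \<kappa> \<le> emeasure lborel (K \<inter> {0<..1})" "0 \<le> \<kappa>" "\<kappa> \<le> 1"
    and a: "\<And>v. v \<in> flat_cone \<Longrightarrow> mass v (surv K j) \<le> ennreal a * mass v UNIV" "0 \<le> a"
    and u: "u \<in> flat_cone"
  shows "mass u (surv K (N + m + j)) \<le> ennreal (4 * 2 ^ N * \<delta> m + (1 - \<kappa> / 4) * a) * mass u UNIV"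
proof -
  have uc: "u \<in> cone" and u4: "\<And>x. u x \<le> 4 * u 1" using u by (auto simp: flat_cone_def)
  have u1: "0 \<le> u 1" using coneD(1)[OF uc] .
  note Kb [measurable] = cyl_sets[OF K]
  obtain f where f: "f \<in> cone"
      "\<And>A. A \<in> sets borel \<Longrightarrow> mass f A = mass u (- K \<inter> (lsv \<alpha> ^^ N) -` A)"
      "\<And>x. f x \<le> 2 ^ N * (4 * u 1)"
    using cyl_transfer[OF cyl_Compl[OF K] uc] u4 by blast
  have M: "ennreal (u 1) \<le> mass u UNIV" "mass u UNIV \<le> ennreal (4 * u 1)"
    using mass_ge[OF uc, of UNIV] mass_le[of UNIV u "4 * u 1"] u4 uc u1 by auto
  then have Mfin: "mass u UNIV < top" by (auto intro: le_less_trans)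
  define M' where "M' = enn2real (mass u UNIV)"
  have M': "mass u UNIV = ennreal M'" "0 \<le> M'" using Mfin by (auto simp: M'_def)
  have "mass u (surv K (N + m + j)) \<le> mass u (- K \<inter> (lsv \<alpha> ^^ N) -` surv K (m + j))"
    using surv_subset_vimage[of K N "m + j"] uc by (intro mass_mono) (auto simp: add.assoc)
  also have "\<dots> = mass f (surv K (m + j))" using f(2)[OF surv_sets[OF Kb]] by simp
  also have "\<dots> \<le> mass f {..\<delta> m} + ennreal a * mass f UNIV"
    using f(1) a(1) by (intro mass_surv_return[of K j] Kb) auto
  also have "mass f {..\<delta> m} \<le> ennreal (4 * 2 ^ N * \<delta> m) * mass u UNIV"
  proof -
    have "mass f {..\<delta> m} \<le> ennreal (2 ^ N * (4 * u 1)) * emeasure lborel ({..\<delta> m} \<inter> {0<..1})"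
      using f u1 by (intro mass_le) auto
    also have "{..\<delta> m} \<inter> {0<..1} = {0<..\<delta> m}" using \<delta>_le_1[of m] by auto
    also have "ennreal (2 ^ N * (4 * u 1)) * emeasure lborel {0<..\<delta> m} =
        ennreal (4 * 2 ^ N * \<delta> m) * ennreal (u 1)"
      using \<delta>_pos[of m] u1 by (simp add: ennreal_mult[symmetric] mult_ac)
    also have "\<dots> \<le> ennreal (4 * 2 ^ N * \<delta> m) * mass u UNIV"
      using M by (intro mult_left_mono) auto
    finally show ?thesis .
  qed
  also have "mass f UNIV \<le> ennreal (1 - \<kappa> / 4) * mass u UNIV"
  proof -
    have fM: "mass f UNIV + mass u K = mass u UNIV"
      using mass_Un[OF uc, of "- K" K] f(2)[of UNIV] Kb by simp
    then have "mass f UNIV \<le> mass u UNIV" "mass u K \<le> mass u UNIV" by (auto simp: fM[symmetric])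
    then have fin: "mass f UNIV < top" "mass u K < top" using Mfin by (auto intro: le_less_trans)
    define F where "F = enn2real (mass f UNIV)"
    have F: "mass f UNIV = ennreal F" "0 \<le> F" using fin by (auto simp: F_def)
    have "ennreal (\<kappa> / 4) * mass u UNIV \<le> ennreal (\<kappa> / 4) * ennreal (4 * u 1)"
      using M by (intro mult_left_mono) auto
    also have "\<dots> = ennreal (u 1) * ennreal \<kappa>"
      using \<kappa> u1 by (simp add: ennreal_mult[symmetric] mult_ac)
    also have "\<dots> \<le> ennreal (u 1) * emeasure lborel (K \<inter> {0<..1})"
      using \<kappa> by (intro mult_left_mono) auto
    also have "\<dots> \<le> mass u K" by (rule mass_ge[OF uc Kb])
    finally have "ennreal F + ennreal (\<kappa> / 4) * ennreal M' \<le> ennreal M'"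
      unfolding F(1)[symmetric] M'(1)[symmetric] fM[symmetric] by (rule add_left_mono)
    then have "ennreal (F + \<kappa> / 4 * M') \<le> ennreal M'"
      using F M' \<kappa> by (simp add: ennreal_mult[symmetric] flip: ennreal_plus)
    then have "F \<le> (1 - \<kappa> / 4) * M'"
      using M' by (simp add: ennreal_le_iff algebra_simps)
    then have "ennreal F \<le> ennreal ((1 - \<kappa> / 4) * M')" by (rule ennreal_leI)
    then show ?thesis unfolding F(1) M'(1) using \<kappa> M'(2) by (simp add: ennreal_mult)
  qed
  also have "ennreal (4 * 2 ^ N * \<delta> m) * mass u UNIV + ennreal a * (ennreal (1 - \<kappa> / 4) * mass u UNIV)
      = ennreal (4 * 2 ^ N * \<delta> m + (1 - \<kappa> / 4) * a) * mass u UNIV"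
  proof -
    have "ennreal (4 * 2 ^ N * \<delta> m + (1 - \<kappa> / 4) * a) =
        ennreal (4 * 2 ^ N * \<delta> m) + ennreal (1 - \<kappa> / 4) * ennreal a"
      using \<kappa> a(2) \<delta>_pos[of m] by (simp add: ennreal_plus ennreal_mult)
    then show ?thesis by (simp only: distrib_right distrib_left mult_ac)
  qed
  finally show ?thesis by (simp add: add_mono mult_left_mono)
qed

lemma flat_cone_one: "indicator {0<..1} \<in> flat_cone"
  using cone_one by (auto simp: flat_cone_def indicator_def)

text \<open>The recursion of \<open>mass_surv_step\<close> has to be solved for all flat densities simultaneously;
  Lebesgue measure is one of them.\<close>
proposition surv_decay:
  assumes K: "K \<in> cyl N" and K_pos: "emeasure lborel (K \<inter> {0<..1}) \<noteq> 0"
  obtains A where "0 < A"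
    "\<And>n. 1 \<le> n \<Longrightarrow> emeasure lborel (surv K n \<inter> {0<..1}) \<le> ennreal (A * real n powr (- 1 / \<alpha>))"
proof -
  note Kb [measurable] = cyl_sets[OF K]
  define \<kappa> where "\<kappa> = measure lborel (K \<inter> {0<..1})"
  have le1: "emeasure lborel (K \<inter> {0<..1}) \<le> 1"
  proof -
    have "emeasure lborel (K \<inter> {0<..1}) \<le> emeasure lborel {0<..1::real}"
      by (intro emeasure_mono) auto
    then show ?thesis by simp
  qed
  then have fin: "emeasure lborel (K \<inter> {0<..1}) < top"
    by (rule le_less_trans) simp
  then have \<kappa>: "emeasure lborel (K \<inter> {0<..1}) = ennreal \<kappa>"
    by (simp add: \<kappa>_def emeasure_eq_ennreal_measure less_top)
  have \<kappa>01: "0 < \<kappa>" "\<kappa> \<le> 1"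
    using K_pos le1 unfolding \<kappa> by (auto simp: \<kappa>_def zero_less_measure_iff)
  define P where "P a n \<longleftrightarrow> (\<forall>u\<in>flat_cone. mass u (surv K n) \<le> ennreal a * mass u UNIV)" for a n
  obtain C where C: "0 < C" "\<And>n. 1 \<le> n \<Longrightarrow> \<delta> n \<le> C * real n powr (- 1 / \<alpha>)"
    using \<delta>_upper by blast
  obtain A where A: "0 < A" "\<And>n. 1 \<le> n \<Longrightarrow> P (A * real n powr - (1 / \<alpha>)) n"
  proof (rule polynomial_decay_recursion[of P "4 * 2 ^ N" \<delta> "1 - \<kappa> / 4" N C "1 / \<alpha>"])
    show "P b n" if "P a n" "a \<le> b" for a b n
      unfolding P_def
    proof
      fix u assume "u \<in> flat_cone"
      then have "mass u (surv K n) \<le> ennreal a * mass u UNIV" using that by (auto simp: P_def)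
      also have "\<dots> \<le> ennreal b * mass u UNIV" using that by (intro mult_right_mono ennreal_leI) auto
      finally show "mass u (surv K n) \<le> ennreal b * mass u UNIV" .
    qed
    show "P 1 n" for n
      by (auto simp: P_def flat_cone_def intro!: mass_mono)
    show "P (4 * 2 ^ N * \<delta> m + (1 - \<kappa> / 4) * a) (N + m + j)" if "0 \<le> a" "P a j" for a j m
      unfolding P_def
    proof
      fix u assume "u \<in> flat_cone"
      then show "mass u (surv K (N + m + j)) \<le> ennreal (4 * 2 ^ N * \<delta> m + (1 - \<kappa> / 4) * a) * mass u UNIV"
        using that K \<kappa> \<kappa>01 by (intro mass_surv_step) (auto simp: P_def)
    qed
    show "\<delta> m \<le> C * real m powr - (1 / \<alpha>)" if "1 \<le> m" for m
      using C(2)[OF that] by simp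
  qed (use C \<kappa>01 alpha_pos in auto)
  have "emeasure lborel (surv K n \<inter> {0<..1}) \<le> ennreal (A * real n powr (- 1 / \<alpha>))" if "1 \<le> n" for n
    using A(2)[OF that] flat_cone_one mass_one[of "surv K n"] mass_one[of UNIV]
    by (auto simp: P_def)
  with A(1) show thesis using that by blast
qed

end

section \<open>Bounds for the invariant measure\<close>

text \<open>A discrete integration: the decrements are dominated by those of a multiple of
  \<open>n powr (1 - \<beta>)\<close>, so the difference of the two sequences increases to its limit \<open>0\<close>.\<close>
lemma tail_sum_bound:
  fixes s :: "nat \<Rightarrow> real"
  assumes step: "\<And>n. 1 \<le> n \<Longrightarrow> s n \<le> s (Suc n) + A * real n powr - \<beta>"
    and lim: "s \<longlonglongrightarrow> 0" and "1 < \<beta>" "0 < A"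
  shows "\<exists>C>0. \<forall>n\<ge>1. s n \<le> C * real n powr (1 - \<beta>)"
proof -
  define C where "C = A * 2 powr \<beta> / (\<beta> - 1)"
  have C: "0 < C" "C * (\<beta> - 1) = A * 2 powr \<beta>" using assms by (auto simp: C_def)
  have gap: "A * real n powr - \<beta> \<le> C * (real n powr (1 - \<beta>) - real (Suc n) powr (1 - \<beta>))"
    if n: "1 \<le> n" for n
  proof -
    have "\<exists>\<xi>>real n. \<xi> < real (Suc n) \<and>
        real (Suc n) powr (1 - \<beta>) - real n powr (1 - \<beta>) =
        (real (Suc n) - real n) * ((1 - \<beta>) * \<xi> powr (1 - \<beta> - 1))"
      using n by (intro MVT2 has_real_derivative_powr) auto
    then obtain \<xi> where \<xi>: "real n < \<xi>" "\<xi> < real (Suc n)"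
      "real n powr (1 - \<beta>) - real (Suc n) powr (1 - \<beta>) = (\<beta> - 1) * \<xi> powr - \<beta>"
      by (auto simp: algebra_simps)
    have "(2 * real n) powr - \<beta> \<le> \<xi> powr - \<beta>"
      using \<xi> n assms by (intro powr_mono2') auto
    then have "A * 2 powr \<beta> * (2 * real n) powr - \<beta> \<le> A * 2 powr \<beta> * \<xi> powr - \<beta>"
      using assms by (intro mult_left_mono) auto
    moreover have "2 powr \<beta> * (2 * real n) powr - \<beta> = real n powr - \<beta>"
      by (simp add: powr_mult powr_minus)
    ultimately have "A * real n powr - \<beta> \<le> C * (\<beta> - 1) * \<xi> powr - \<beta>"
      unfolding C(2) by (simp add: mult.assoc)
    then show ?thesis unfolding \<xi>(3) by (simp add: mult.assoc)
  qed
  define X where "X n = s (Suc n) - C * real (Suc n) powr (1 - \<beta>)" for n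
  have "incseq X"
  proof (rule incseq_SucI)
    fix n show "X n \<le> X (Suc n)"
      using step[of "Suc n"] gap[of "Suc n"] by (simp add: X_def algebra_simps)
  qed
  moreover have "X \<longlonglongrightarrow> 0"
  proof -
    have "(\<lambda>n. C * real n powr (1 - \<beta>)) \<longlonglongrightarrow> C * 0"
      using assms by (intro tendsto_mult tendsto_const tendsto_neg_powr filterlim_real_sequentially) auto
    then have "(\<lambda>n. s n - C * real n powr (1 - \<beta>)) \<longlonglongrightarrow> 0 - C * 0"
      using lim by (intro tendsto_diff)
    then show ?thesis unfolding X_def by (subst filterlim_sequentially_Suc) simp
  qed
  ultimately have X: "X n \<le> 0" for n by (rule incseq_le)
  have "s n \<le> C * real n powr (1 - \<beta>)" if "1 \<le> n" for n
    using X[of "n - 1"] that by (simp add: X_def)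
  then show ?thesis using C(1) by blast
qed

locale lsv_acim = lsv_map +
  fixes \<mu> :: "real measure"
  assumes srb: "lsv_SRB \<alpha> \<mu>"
begin

lemma sets_\<mu>: "sets \<mu> = sets (restrict_space borel {0..1})"
  and prob_space_\<mu>: "prob_space \<mu>"
  and distr_\<mu>: "distr \<mu> \<mu> (lsv \<alpha>) = \<mu>"
  and lsv_measurable_\<mu>: "lsv \<alpha> \<in> \<mu> \<rightarrow>\<^sub>M \<mu>"
  and ac_\<mu>: "absolutely_continuous (restrict_space lborel {0..1}) \<mu>"
  using srb by (auto simp: lsv_SRB_def)

sublocale prob_space \<mu> by (rule prob_space_\<mu>)

lemma space_\<mu>: "space \<mu> = {0..1}"
  using sets_eq_imp_space_eq[OF sets_\<mu>] by (simp add: space_restrict_space)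

lemma sets_\<mu>_iff: "A \<in> sets \<mu> \<longleftrightarrow> A \<in> sets borel \<and> A \<subseteq> {0..1}"
  unfolding sets_\<mu> by (subst sets_restrict_space_iff) auto

text \<open>The origin is dropped from the domain of integration since the cone lives on \<open>{0<..1}\<close>.\<close>
lemma density_exists:
  obtains \<phi> where "\<phi> \<in> borel_measurable borel"
    "\<And>B. B \<in> sets borel \<Longrightarrow> emeasure \<mu> (B \<inter> {0..1}) = wmass \<phi> B"
proof -
  let ?M = "restrict_space lborel {0..1::real}"
  interpret M: finite_measure ?M
    by (rule finite_measureI) (simp add: emeasure_restrict_space space_restrict_space)
  have "sets \<mu> = sets ?M"
    unfolding sets_\<mu> by (intro sets_restrict_space_cong) simp
  with M.Radon_Nikodym[OF ac_\<mu>] obtain \<psi> where \<psi>: "\<psi> \<in> borel_measurable ?M" "density ?M \<psi> = \<mu>"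
    by auto
  define \<phi> where "\<phi> x = \<psi> x * indicator {0..1} x" for x
  have \<phi>: "\<phi> \<in> borel_measurable borel"
    using \<psi>(1) unfolding \<phi>_def by (subst (asm) borel_measurable_restrict_space_iff_ennreal) auto
  have "emeasure \<mu> (B \<inter> {0..1}) = wmass \<phi> B" if B: "B \<in> sets borel" for B
  proof -
    have "emeasure \<mu> (B \<inter> {0..1}) = (\<integral>\<^sup>+x. \<psi> x * indicator (B \<inter> {0..1}) x \<partial>?M)"
      unfolding \<psi>(2)[symmetric] using B \<psi>(1)
      by (intro emeasure_density) (auto simp: sets_restrict_space_iff)
    also have "\<dots> = (\<integral>\<^sup>+x. \<psi> x * indicator (B \<inter> {0..1}) x * indicator {0..1} x \<partial>lborel)"
      by (rule nn_integral_restrict_space) simp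
    also have "\<dots> = wmass \<phi> B"
      unfolding wmass_def
    proof (intro nn_integral_cong_AE)
      show "AE x in lborel. \<psi> x * indicator (B \<inter> {0..1}) x * indicator {0..1} x =
          \<phi> x * indicator (B \<inter> {0<..1}) x"
        using AE_lborel_singleton[of 0] by eventually_elim (auto simp: \<phi>_def indicator_def)
    qed
    finally show ?thesis .
  qed
  with \<phi> show thesis using that by blast
qed

text \<open>The measure \<open>\<mu>\<close> as a function on Borel sets of the line, where preimages under \<open>lsv \<alpha>\<close> can be
  taken without intersecting with the unit interval.\<close>
definition m :: "real set \<Rightarrow> real" where
  "m B = measure \<mu> (B \<inter> {0..1})"

lemma m_nonneg: "0 \<le> m B" by (simp add: m_def)

lemma m_le_1: "m B \<le> 1" by (simp add: m_def prob_le_1)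

lemma m_vimage: "m (lsv \<alpha> -` B) = m B" if "B \<in> sets borel"
proof -
  have "measure \<mu> (B \<inter> {0..1}) = measure (distr \<mu> \<mu> (lsv \<alpha>)) (B \<inter> {0..1})"
    by (simp add: distr_\<mu>)
  also have "\<dots> = measure \<mu> (lsv \<alpha> -` (B \<inter> {0..1}) \<inter> {0..1})"
    using that by (subst measure_distr) (auto simp: sets_\<mu>_iff lsv_measurable_\<mu> space_\<mu>)
  also have "lsv \<alpha> -` (B \<inter> {0..1}) \<inter> {0..1} = lsv \<alpha> -` B \<inter> {0..1}"
    using measurable_space[OF lsv_measurable_\<mu>] by (auto simp: space_\<mu>)
  finally show ?thesis by (simp add: m_def)
qed

lemma emeasure_eq_m: "emeasure \<mu> (B \<inter> {0..1}) = ennreal (m B)"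
  by (simp add: m_def emeasure_eq_measure)

lemma m_null: "m B = 0" if "B \<in> sets borel" "emeasure lborel (B \<inter> {0<..1}) = 0"
proof -
  obtain \<phi> where \<phi>: "\<phi> \<in> borel_measurable borel"
    "\<And>B. B \<in> sets borel \<Longrightarrow> emeasure \<mu> (B \<inter> {0..1}) = wmass \<phi> B"
    using density_exists by blast
  have "AE x in lborel. x \<notin> B \<inter> {0<..1}"
    using that by (intro AE_not_in) (auto simp: null_sets_def)
  then have "wmass \<phi> B = (\<integral>\<^sup>+x. 0 \<partial>(lborel :: real measure))"
    unfolding wmass_def by (intro nn_integral_cong_AE) (auto elim!: eventually_mono)
  then have "ennreal (m B) = 0"
    using \<phi>(2)[OF that(1)] by (simp add: emeasure_eq_m)
  then show ?thesis using m_nonneg[of B] by (simp add: ennreal_eq_0_iff)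
qed

lemma m_Un: "m (A \<union> B) = m A + m B"
  if "A \<in> sets borel" "B \<in> sets borel" "A \<inter> B = {}"
  unfolding m_def Int_Un_distrib2 using that
  by (intro finite_measure_Union) (auto simp: sets_\<mu>_iff)

lemma m_mono: "m A \<le> m B" if A: "A \<in> sets borel" and B: "B \<in> sets borel" and sub: "A \<inter> {0<..1} \<subseteq> B"
proof -
  have "m A \<le> m ((A - {0}) \<union> {0})"
    unfolding m_def using A by (intro finite_measure_mono) (auto simp: sets_\<mu>_iff)
  also have "\<dots> = m (A - {0}) + m {0}"
    using A by (intro m_Un) auto
  also have "m {0} = 0" by (rule m_null) auto
  also have "m (A - {0}) \<le> m B"
    unfolding m_def using A B sub by (intro finite_measure_mono) (auto simp: sets_\<mu>_iff)
  finally show ?thesis by simp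
qed

lemma m_cong: "m A = m B" if "A \<in> sets borel" "B \<in> sets borel" "A \<inter> {0<..1} = B \<inter> {0<..1}"
  using that by (intro antisym m_mono) auto

lemma m_comparable:
  assumes A: "A \<in> sets borel" "A \<subseteq> {1/2<..1}" and B: "B \<in> sets borel" "B \<subseteq> {1/2<..1}"
  shows "measure lborel B * m A \<le> 4 * measure lborel A * m B"
proof -
  obtain \<phi> where \<phi>: "\<phi> \<in> borel_measurable borel"
    "\<And>B. B \<in> sets borel \<Longrightarrow> emeasure \<mu> (B \<inter> {0..1}) = wmass \<phi> B"
    using density_exists by blast
  have w: "wmass \<phi> E = ennreal (m E)" if "E \<in> sets borel" for E
    using \<phi>(2)[OF that] emeasure_eq_m by simp
  have fin: "emeasure lborel E = ennreal (measure lborel E)" if "E \<subseteq> {1/2<..1::real}" for E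
  proof -
    have "emeasure lborel E \<le> emeasure lborel {0..1::real}"
      using that by (intro emeasure_mono) auto
    then have "emeasure lborel E < top" by (rule le_less_trans) simp
    then show ?thesis by (simp add: emeasure_eq_ennreal_measure less_top)
  qed
  have "emeasure lborel B * wmass \<phi> A \<le> 4 * emeasure lborel A * wmass \<phi> B"
    using A B by (intro invariant_density_comparable \<phi>) (auto simp: w m_vimage)
  then have "ennreal (measure lborel B * m A) \<le> ennreal (4 * measure lborel A * m B)"
    unfolding w[OF A(1)] w[OF B(1)] fin[OF A(2)] fin[OF B(2)]
    using m_nonneg by (simp add: ennreal_mult)
  then show ?thesis
    using m_nonneg by (subst (asm) ennreal_le_iff) auto
qed

lemma m_upper: "m A \<le> 8 * measure lborel A" if A: "A \<in> sets borel" "A \<subseteq> {1/2<..1}"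
proof -
  have "1/2 * m A \<le> 4 * measure lborel A * m {1/2<..1}"
    using m_comparable[OF A, of "{1/2<..1}"] by simp
  also have "\<dots> \<le> 4 * measure lborel A * 1"
    using m_le_1 by (intro mult_left_mono) auto
  finally show ?thesis by simp
qed

text \<open>Invariance for the interval \<open>{..\<delta> n}\<close>, whose preimage consists of \<open>{..\<delta> (Suc n)}\<close> and of an
  interval to the right of \<open>1/2\<close>.\<close>
lemma m_atMost_\<delta>_Suc: "m {..\<delta> n} = m {..\<delta> (Suc n)} + m {1/2<..(1 + \<delta> n) / 2}"
proof -
  have "m {..\<delta> n} = m (lsv \<alpha> -` {..\<delta> n})" by (simp add: m_vimage)
  also have "\<dots> = m ({..1/2} \<inter> lsv \<alpha> -` {..\<delta> n}) + m ({1/2<..} \<inter> lsv \<alpha> -` {..\<delta> n})"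
    by (subst lsv_vimage_split, rule m_Un) auto
  also have "m ({..1/2} \<inter> lsv \<alpha> -` {..\<delta> n}) = m {..\<delta> (Suc n)}"
    using vimage_\<delta>[of n] by (intro m_cong) auto
  also have "m ({1/2<..} \<inter> lsv \<alpha> -` {..\<delta> n}) = m {1/2<..(1 + \<delta> n) / 2}"
    by (intro m_cong) (auto simp: lsv_right)
  finally show ?thesis .
qed

text \<open>Otherwise all the intervals \<open>{..\<delta> n}\<close> would have full measure, and so would the origin.\<close>
lemma m_right_pos: "0 < m {1/2<..1}"
proof (rule ccontr)
  assume "\<not> 0 < m {1/2<..1}"
  then have 0: "m {1/2<..1} = 0" using m_nonneg[of "{1/2<..1}"] by simp
  have 1: "m {..\<delta> n} = 1" for n
  proof (induction n)
    case 0
    have "m {..1} = measure \<mu> (space \<mu>)"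
      unfolding m_def space_\<mu> by (intro arg_cong[where f = "measure \<mu>"]) auto
    then show ?case by (simp add: prob_space)
  next
    case (Suc n)
    have "m {1/2<..(1 + \<delta> n) / 2} \<le> m {1/2<..1}"
      using \<delta>_le_1[of n] by (intro m_mono) auto
    then show ?case using Suc m_atMost_\<delta>_Suc[of n] 0 m_nonneg[of "{1/2<..(1 + \<delta> n) / 2}"] by simp
  qed
  have "(\<lambda>n. measure \<mu> ({..\<delta> n} \<inter> {0..1})) \<longlonglongrightarrow> measure \<mu> (\<Inter>n. {..\<delta> n} \<inter> {0..1})"
  proof (rule finite_Lim_measure_decseq)
    show "decseq (\<lambda>n. {..\<delta> n} \<inter> {0..1})"
      unfolding decseq_def using order_trans[OF _ \<delta>_antimono] by blast
  qed (auto simp: sets_\<mu>_iff)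
  moreover have "(\<Inter>n. {..\<delta> n} \<inter> {0..1}) = {0} \<inter> {0..1}"
  proof -
    have "x = 0" if "\<And>n. x \<le> \<delta> n" "0 \<le> x" for x
      using LIMSEQ_le_const[OF \<delta>_tendsto_0, of x] that by auto
    then show ?thesis using \<delta>_pos by (auto simp: less_imp_le)
  qed
  ultimately have "(\<lambda>n. m {..\<delta> n}) \<longlonglongrightarrow> m {0}" by (simp add: m_def)
  moreover have "m {0} = 0" by (rule m_null) auto
  ultimately have "(\<lambda>n. 1::real) \<longlonglongrightarrow> 0" by (simp add: 1)
  then show False using LIMSEQ_unique[OF tendsto_const] by fastforce
qed

lemma m_lower:
  "\<exists>c>0. \<forall>B\<in>sets borel. B \<subseteq> {1/2<..1} \<longrightarrow> c * measure lborel B \<le> m B"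
proof (intro exI[of _ "m {1/2<..1} / 2"] conjI ballI impI)
  fix B :: "real set" assume "B \<in> sets borel" "B \<subseteq> {1/2<..1}"
  then show "m {1/2<..1} / 2 * measure lborel B \<le> m B"
    using m_comparable[of "{1/2<..1}" B] by (simp add: mult.commute)
qed (use m_right_pos in auto)

lemma m_atMost_\<delta>_lower: "\<exists>c>0. \<forall>n\<ge>1. c * real n powr (1 - 1 / \<alpha>) \<le> m {..\<delta> n}"
proof -
  obtain c where c: "0 < c" "\<And>B. B \<in> sets borel \<Longrightarrow> B \<subseteq> {1/2<..1} \<Longrightarrow> c * measure lborel B \<le> m B"
    using m_lower by blast
  obtain d where d: "0 < d" "\<And>n. 1 \<le> n \<Longrightarrow> d * real n powr (- 1 / \<alpha>) \<le> \<delta> n"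
    using \<delta>_lower by blast
  have step: "c / 2 * \<delta> n + m {..\<delta> (Suc n)} \<le> m {..\<delta> n}" for n
  proof -
    have "{1/2<..(1 + \<delta> n) / 2} \<subseteq> {1/2<..1}" using \<delta>_le_1[of n] by auto
    then have "c * measure lborel {1/2<..(1 + \<delta> n) / 2} \<le> m {1/2<..(1 + \<delta> n) / 2}"
      by (intro c) auto
    moreover have "measure lborel {1/2<..(1 + \<delta> n) / 2} = \<delta> n / 2"
      using \<delta>_pos[of n] by (simp add: add_divide_distrib)
    ultimately show ?thesis using m_atMost_\<delta>_Suc[of n] by simp
  qed
  have sum_le: "real j * (c / 2 * \<delta> (n + j)) \<le> m {..\<delta> n} - m {..\<delta> (n + j)}" for n j
  proof (induction j)
    case (Suc j)
    have "real (Suc j) * (c / 2 * \<delta> (n + Suc j)) \<le> real (Suc j) * (c / 2 * \<delta> (n + j))"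
      using c \<delta>_antimono[of "n + j" "n + Suc j"] by (intro mult_left_mono) auto
    also have "\<dots> = real j * (c / 2 * \<delta> (n + j)) + c / 2 * \<delta> (n + j)"
      by (simp add: distrib_right)
    also have "\<dots> \<le> m {..\<delta> n} - m {..\<delta> (n + Suc j)}"
      using Suc step[of "n + j"] by simp
    finally show ?case .
  qed simp
  show ?thesis
  proof (intro exI conjI allI impI)
    show "0 < c / 2 * d * 2 powr (- 1 / \<alpha>)" using c d by simp
    fix n :: nat assume n: "1 \<le> n"
    have "d * real (n + n) powr (- 1 / \<alpha>) \<le> \<delta> (n + n)" using d(2)[of "n + n"] n by simp
    then have "real n * (c / 2 * (d * real (n + n) powr (- 1 / \<alpha>))) \<le> real n * (c / 2 * \<delta> (n + n))"
      using c by (intro mult_left_mono) auto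
    also have "\<dots> \<le> m {..\<delta> n}" using sum_le[of n n] m_nonneg[of "{..\<delta> (n + n)}"] by linarith
    also have "real n * (c / 2 * (d * real (n + n) powr (- 1 / \<alpha>))) =
        c / 2 * d * 2 powr (- 1 / \<alpha>) * real n powr (1 - 1 / \<alpha>)"
    proof -
      have "real n powr (1 - 1 / \<alpha>) = real n * real n powr (- 1 / \<alpha>)"
        using n by (simp add: powr_diff powr_minus field_simps)
      moreover have "real (n + n) = 2 * real n" by simp
      ultimately show ?thesis by (simp only: powr_mult) (simp add: mult_ac)
    qed
    finally show "c / 2 * d * 2 powr (- 1 / \<alpha>) * real n powr (1 - 1 / \<alpha>) \<le> m {..\<delta> n}" .
  qed
qed

text \<open>Since \<open>K\<close> lies in the right half, the decrement of \<open>m (surv K n)\<close> is bounded by the Lebesgue measure of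
  \<open>surv K n\<close>, up to a constant; the measures tend to \<open>0\<close> because \<open>\<mu>\<close> is absolutely continuous.\<close>
lemma m_surv_upper:
  assumes K: "K \<in> cyl N" "K \<inter> {0<..1} \<subseteq> {1/2<..}" and K_pos: "emeasure lborel (K \<inter> {0<..1}) \<noteq> 0"
  shows "\<exists>C>0. \<forall>n\<ge>1. m (surv K n) \<le> C * real n powr (1 - 1 / \<alpha>)"
proof -
  note Kb [measurable] = cyl_sets[OF K(1)]
  obtain A where A: "0 < A"
    "\<And>n. 1 \<le> n \<Longrightarrow> emeasure lborel (surv K n \<inter> {0<..1}) \<le> ennreal (A * real n powr (- 1 / \<alpha>))"
    using surv_decay[OF K(1) K_pos] by blast
  have step: "m (surv K n) \<le> m (surv K (Suc n)) + 8 * A * real n powr - (1 / \<alpha>)" if n: "1 \<le> n" for n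
  proof -
    let ?T = "{1/2<..1} \<inter> lsv \<alpha> -` surv K n"
    have "m (surv K n) = m (lsv \<alpha> -` surv K n)" by (simp add: m_vimage Kb)
    also have "lsv \<alpha> -` surv K n = surv K (Suc n) \<union> (K \<inter> lsv \<alpha> -` surv K n)"
      by (auto simp: surv_Suc)
    also have "m \<dots> = m (surv K (Suc n)) + m (K \<inter> lsv \<alpha> -` surv K n)"
      using Kb by (intro m_Un) (auto simp: surv_Suc)
    also have "m (K \<inter> lsv \<alpha> -` surv K n) \<le> m ?T"
      using K(2) Kb by (intro m_mono) auto
    also have "\<dots> \<le> 8 * measure lborel ?T"
      using Kb by (intro m_upper) auto
    also have "measure lborel ?T \<le> A * real n powr (- 1 / \<alpha>)"
    proof -
      have PR1: "PR (indicator {0<..1}) x \<le> indicator {0<..1} x" for x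
        by (auto simp: PR_def indicator_def)
      have "emeasure lborel ?T = mass (indicator {0<..1}) ({1/2<..} \<inter> lsv \<alpha> -` surv K n)"
        using Kb by (subst mass_one) (auto intro!: arg_cong[where f = "emeasure lborel"])
      also have "\<dots> = mass (PR (indicator {0<..1})) (surv K n)"
        using mass_PR[OF cone_one surv_sets[OF Kb]] by simp
      also have "\<dots> \<le> mass (indicator {0<..1}) (surv K n)"
        unfolding mass_def using PR1
        by (intro nn_integral_mono mult_right_mono ennreal_leI) auto
      also have "\<dots> \<le> ennreal (A * real n powr (- 1 / \<alpha>))"
        using A(2)[OF n] Kb by (simp add: mass_one)
      finally show ?thesis
        using A(1) by (simp add: measure_def enn2real_leI)
    qed
    finally show ?thesis by simp
  qed
  have null: "m (\<Inter>n. surv K n) = 0"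
  proof (rule m_null)
    show "(\<Inter>n. surv K n) \<in> sets borel" using Kb by auto
    have "emeasure lborel ((\<Inter>n. surv K n) \<inter> {0<..1}) \<le> ennreal (A * real n powr (- 1 / \<alpha>))" if "1 \<le> n" for n
      using Kb by (intro order_trans[OF emeasure_mono A(2)[OF that]]) auto
    moreover have "(\<lambda>n. ennreal (A * real n powr (- 1 / \<alpha>))) \<longlonglongrightarrow> ennreal (A * 0)"
      using alpha_pos
      by (intro tendsto_ennrealI tendsto_mult tendsto_const tendsto_neg_powr filterlim_real_sequentially) auto
    ultimately have "emeasure lborel ((\<Inter>n. surv K n) \<inter> {0<..1}) \<le> ennreal (A * 0)"
      by (intro tendsto_lowerbound[where F = sequentially]) (auto intro: eventually_sequentiallyI)
    then show "emeasure lborel ((\<Inter>n. surv K n) \<inter> {0<..1}) = 0" by simp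
  qed
  have "(\<lambda>n. measure \<mu> (surv K n \<inter> {0..1})) \<longlonglongrightarrow> measure \<mu> (\<Inter>n. surv K n \<inter> {0..1})"
    using Kb surv_antimono
    by (intro finite_Lim_measure_decseq) (fastforce simp: sets_\<mu>_iff decseq_def)+
  moreover have "(\<Inter>n. surv K n \<inter> {0..1}) = (\<Inter>n. surv K n) \<inter> {0..1}" by auto
  ultimately have "(\<lambda>n. m (surv K n)) \<longlonglongrightarrow> 0" using null by (simp add: m_def)
  with step show ?thesis
    by (rule tail_sum_bound) (use A alpha_pos alpha_less_1 in auto)
qed

section \<open>Tails of the hitting time\<close>

lemma hitting_time_gt_iff:
  "enat n < hitting_time f H x \<longleftrightarrow> (\<forall>k. 1 \<le> k \<and> k \<le> n \<longrightarrow> (f ^^ k) x \<notin> H)"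
proof -
  have "enat n < hitting_time f H x \<longleftrightarrow> enat (Suc n) \<le> hitting_time f H x"
    by (simp add: Suc_ile_eq)
  also have "\<dots> \<longleftrightarrow> (\<forall>k. 1 \<le> k \<and> k \<le> n \<longrightarrow> (f ^^ k) x \<notin> H)"
    unfolding hitting_time_def le_Inf_iff by (auto simp: not_less_eq_eq)
  finally show ?thesis .
qed

lemma lsv_orbit_below: "(lsv \<alpha> ^^ k) x \<le> \<delta> j" if "x \<in> {0<..\<delta> (k + j)}"
  using that
proof (induction k arbitrary: x)
  case (Suc k)
  have "x \<in> ({..1/2} \<inter> lsv \<alpha> -` {..\<delta> (k + j)}) \<inter> {0<..1}"
    unfolding vimage_\<delta> using Suc.prems \<delta>_le_1[of "Suc (k + j)"] by auto
  then have "lsv \<alpha> x \<in> {0<..\<delta> (k + j)}" using lsv_range[of x] by auto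
  then show ?case using Suc.IH by (simp add: funpow_Suc_right del: funpow.simps(2))
qed simp

lemma hitting_tail_lower:
  assumes H: "H \<in> sets \<mu>" and r: "0 < r" "\<And>x. 0 < x \<Longrightarrow> x < r \<Longrightarrow> x \<notin> H"
  shows "\<exists>c>0. \<forall>n\<ge>1. c * real n powr (1 - 1 / \<alpha>) \<le>
    measure \<mu> {x \<in> {0..1}. hitting_time (lsv \<alpha>) H x > enat n}"
proof -
  have Hb [measurable]: "H \<in> sets borel" using H by (simp add: sets_\<mu>_iff)
  obtain c where c: "0 < c" "\<And>n. 1 \<le> n \<Longrightarrow> c * real n powr (1 - 1 / \<alpha>) \<le> m {..\<delta> n}"
    using m_atMost_\<delta>_lower by blast
  obtain M where M: "\<delta> M < r"
    using eventually_happens'[OF sequentially_bot order_tendstoD(2)[OF \<delta>_tendsto_0 r(1)]] by blast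
  show ?thesis
  proof (intro exI conjI allI impI)
    show "0 < c * (1 + real M) powr (1 - 1 / \<alpha>)" using c by simp
    fix n :: nat assume n: "1 \<le> n"
    have e: "1 - 1 / \<alpha> \<le> 0" using alpha_pos alpha_less_1 by simp
    have "real (n + M) \<le> (1 + real M) * real n"
      using n mult_left_mono[of 1 "real n" "real M"] by (simp add: algebra_simps)
    then have "((1 + real M) * real n) powr (1 - 1 / \<alpha>) \<le> real (n + M) powr (1 - 1 / \<alpha>)"
      using e n by (intro powr_mono2') auto
    then have "c * (1 + real M) powr (1 - 1 / \<alpha>) * real n powr (1 - 1 / \<alpha>) \<le> c * real (n + M) powr (1 - 1 / \<alpha>)"
      using c by (simp add: powr_mult mult.assoc)
    also have "\<dots> \<le> m {..\<delta> (n + M)}" using c(2)[of "n + M"] n by simp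
    also have "\<dots> = m {0<..\<delta> (n + M)}"
      by (intro m_cong) auto
    also have "\<dots> \<le> measure \<mu> {x \<in> {0..1}. hitting_time (lsv \<alpha>) H x > enat n}"
      unfolding m_def
    proof (intro finite_measure_mono subsetI)
      fix x assume x: "x \<in> {0<..\<delta> (n + M)} \<inter> {0..1}"
      have "(lsv \<alpha> ^^ k) x \<notin> H" if "1 \<le> k" "k \<le> n" for k
      proof (rule r(2))
        show "0 < (lsv \<alpha> ^^ k) x" using funpow_lsv_range[of x k] x by auto
        have "x \<in> {0<..\<delta> (k + (n - k + M))}" using x that by simp
        then have "(lsv \<alpha> ^^ k) x \<le> \<delta> (n - k + M)" by (rule lsv_orbit_below)
        also have "\<dots> \<le> \<delta> M" by (intro \<delta>_antimono) simp
        finally show "(lsv \<alpha> ^^ k) x < r" using M by simp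
      qed
      then show "x \<in> {x \<in> {0..1}. enat n < hitting_time (lsv \<alpha>) H x}"
        using x by (auto simp: hitting_time_gt_iff)
    next
      have "{x \<in> {0..1}. enat n < hitting_time (lsv \<alpha>) H x} =
          {0..1} \<inter> (\<Inter>k\<in>{k. 1 \<le> k \<and> k \<le> n}. (lsv \<alpha> ^^ k) -` (- H))"
        by (auto simp: hitting_time_gt_iff)
      also have "\<dots> \<in> sets \<mu>"
        unfolding sets_\<mu>_iff using n by (intro conjI sets.Int sets.countable_INT') auto
      finally show "{x \<in> {0..1}. enat n < hitting_time (lsv \<alpha>) H x} \<in> sets \<mu>" .
    qed
    finally show "c * (1 + real M) powr (1 - 1 / \<alpha>) * real n powr (1 - 1 / \<alpha>) \<le>
      measure \<mu> {x \<in> {0..1}. hitting_time (lsv \<alpha>) H x > enat n}" .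
  qed
qed

text \<open>The right preimage of an interval in the hole lies in \<open>{1/2<..1}\<close> wherever the hole is, and it contains
  a cylinder set \<open>K\<close>. A visit to \<open>K\<close> is followed by a visit to the hole one step later.\<close>
lemma hitting_tail_upper:
  assumes ab: "0 \<le> a" "a < b" "b \<le> 1" and H: "{a<..<b} \<subseteq> H"
  shows "\<exists>C>0. \<forall>n\<ge>1. measure \<mu> {x \<in> {0..1}. hitting_time (lsv \<alpha>) H x > enat n}
    \<le> C * real n powr (1 - 1 / \<alpha>)"
proof -
  have "0 < (b - a) / 6" using ab by simp
  then obtain N where N: "\<delta> N < (b - a) / 6"
    using eventually_happens'[OF sequentially_bot order_tendstoD(2)[OF \<delta>_tendsto_0]] by blast
  have pos: "0 < \<delta> N" by (rule \<delta>_pos)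
  have pq: "0 \<le> (1 + a) / 2 + \<delta> N" "(1 + a) / 2 + \<delta> N \<le> 1"
    "0 \<le> (1 + b) / 2 - \<delta> N" "(1 + b) / 2 - \<delta> N \<le> 1"
    using ab N pos by (auto simp: field_simps)
  obtain V e where V: "V \<in> cyl N" "V \<inter> {0<..1} = {0<..e}" "0 \<le> e"
      "e \<le> (1 + a) / 2 + \<delta> N" "(1 + a) / 2 + \<delta> N - e \<le> \<delta> N"
    by (rule cyl_interval[OF pq(1,2), of N])
  obtain W h where W: "W \<in> cyl N" "W \<inter> {0<..1} = {0<..h}" "0 \<le> h"
      "h \<le> (1 + b) / 2 - \<delta> N" "(1 + b) / 2 - \<delta> N - h \<le> \<delta> N"
    by (rule cyl_interval[OF pq(3,4), of N])
  \<comment> \<open>Approximation from below within \<open>\<delta> N\<close> forces a shift of the left endpoint by \<open>\<delta> N\<close> to stay inside the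
    interval \<open>((1 + a) / 2, (1 + b) / 2)\<close>; the right endpoint is moved as well to keep \<open>h\<close> strictly
    inside. Its length \<open>(b - a) / 2\<close> exceeds \<open>3 * \<delta> N\<close>, so \<open>e < h\<close>.\<close>
  define K where "K = W \<inter> - V"
  have K: "K \<in> cyl N" unfolding K_def using V W by (intro cyl_Int cyl_Compl)
  have eh: "(1 + a) / 2 \<le> e" "e < h" "h < (1 + b) / 2"
    using V(4,5) W(4,5) N pos by (auto simp: field_simps)
  have K_eq: "K \<inter> {0<..1} = {e<..h}"
  proof -
    have "K \<inter> {0<..1} = (W \<inter> {0<..1}) - (V \<inter> {0<..1})" by (auto simp: K_def)
    also have "\<dots> = {e<..h}" unfolding V(2) W(2) using V(3) by auto
    finally show ?thesis .
  qed
  obtain C where C: "0 < C" "\<And>n. 1 \<le> n \<Longrightarrow> m (surv K n) \<le> C * real n powr (1 - 1 / \<alpha>)"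
    using m_surv_upper[OF K] eh ab unfolding K_eq by fastforce
  have hit: "lsv \<alpha> x \<in> H" if "x \<in> K" "x \<in> {0<..1}" for x
  proof -
    have "x \<in> {e<..h}" using that K_eq by auto
    then have "1/2 < x" "2 * x - 1 \<in> {a<..<b}" using eh ab by auto
    then show ?thesis using H by (auto simp: lsv_right)
  qed
  have e: "1 - 1 / \<alpha> \<le> 0" using alpha_pos alpha_less_1 by simp
  show ?thesis
  proof (intro exI conjI allI impI)
    show "0 < max 1 (C * (1/2) powr (1 - 1 / \<alpha>))" by simp
    fix n :: nat assume n: "1 \<le> n"
    show "measure \<mu> {x \<in> {0..1}. hitting_time (lsv \<alpha>) H x > enat n}
        \<le> max 1 (C * (1/2) powr (1 - 1 / \<alpha>)) * real n powr (1 - 1 / \<alpha>)"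
    proof (cases "n = 1")
      case True
      then show ?thesis using prob_le_1 by (auto intro: order_trans[OF _ max.cobounded1])
    next
      case False
      then obtain k where k: "n = Suc k" "1 \<le> k" using n by (cases n) auto
      have "{x \<in> {0..1}. enat n < hitting_time (lsv \<alpha>) H x} \<subseteq> (surv K k \<union> {0}) \<inter> {0..1}"
      proof
        fix x assume x: "x \<in> {x \<in> {0..1}. enat n < hitting_time (lsv \<alpha>) H x}"
        show "x \<in> (surv K k \<union> {0}) \<inter> {0..1}"
        proof (cases "x = 0")
          case False
          then have x01: "x \<in> {0<..1}" using x by auto
          have "(lsv \<alpha> ^^ j) x \<notin> K" if "j \<le> k" for j
          proof
            assume "(lsv \<alpha> ^^ j) x \<in> K"
            then have "(lsv \<alpha> ^^ Suc j) x \<in> H" using hit funpow_lsv_range[OF x01] by simp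
            moreover have "(lsv \<alpha> ^^ Suc j) x \<notin> H"
              using x that k unfolding hitting_time_gt_iff by (simp del: funpow.simps)
            ultimately show False by blast
          qed
          then show ?thesis using x by (auto simp: surv_def)
        qed simp
      qed
      then have "measure \<mu> {x \<in> {0..1}. hitting_time (lsv \<alpha>) H x > enat n} \<le> m (surv K k \<union> {0})"
        unfolding m_def using cyl_sets[OF K]
        by (intro finite_measure_mono) (auto simp: sets_\<mu>_iff)
      also have "\<dots> \<le> m (surv K k)" using cyl_sets[OF K] by (intro m_mono) auto
      also have "\<dots> \<le> C * real k powr (1 - 1 / \<alpha>)" by (rule C(2)[OF k(2)])
      also have "\<dots> \<le> C * (1/2 * real n) powr (1 - 1 / \<alpha>)"
        using C k e by (intro mult_left_mono powr_mono2') auto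
      also have "\<dots> = C * (1/2) powr (1 - 1 / \<alpha>) * real n powr (1 - 1 / \<alpha>)"
        by (simp only: powr_mult mult.assoc)
      also have "\<dots> \<le> max 1 (C * (1/2) powr (1 - 1 / \<alpha>)) * real n powr (1 - 1 / \<alpha>)"
        by (intro mult_right_mono) auto
      finally show ?thesis .
    qed
  qed
qed

end

lemma interval_in_relative_interior:
  assumes "(top_of_set {0..1::real}) interior_of H \<noteq> {}"
  obtains a b where "0 \<le> a" "a < b" "b \<le> 1" "{a<..<b} \<subseteq> H"
proof -
  obtain x T where T: "openin (top_of_set {0..1}) T" "x \<in> T" "T \<subseteq> H"
    using assms unfolding interior_of_def by blast
  then obtain U where U: "open U" "T = {0..1} \<inter> U" by (auto simp: openin_open)
  then obtain e where e: "0 < e" "ball x e \<subseteq> U" using T(2) by (meson IntD2 open_contains_ball)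
  have x: "0 \<le> x" "x \<le> 1" using T U by auto
  show thesis
  proof
    show "0 \<le> max 0 (x - e)" "max 0 (x - e) < min 1 (x + e)" "min 1 (x + e) \<le> 1"
      using x e by auto
    have "y \<in> H" if "y \<in> {max 0 (x - e)<..<min 1 (x + e)}" for y
    proof -
      have "y \<in> ball x e" using that by (auto simp: dist_real_def abs_less_iff)
      then have "y \<in> T" using e U that by auto
      then show ?thesis using T by blast
    qed
    then show "{max 0 (x - e)<..<min 1 (x + e)} \<subseteq> H" by blast
  qed
qed

lemma gap_at_zero:
  assumes "0 \<notin> (top_of_set {0..1::real}) closure_of H" "H \<subseteq> {0..1}"
  obtains r where "0 < r" "\<And>x. 0 < x \<Longrightarrow> x < r \<Longrightarrow> x \<notin> H"
proof -
  obtain T where T: "openin (top_of_set {0..1}) T" "0 \<in> T" "T \<inter> H = {}"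
    using assms(1) unfolding in_closure_of by (auto simp: disjoint_iff)
  then obtain U where U: "open U" "T = {0..1} \<inter> U" by (auto simp: openin_open)
  then obtain e where e: "0 < e" "ball 0 e \<subseteq> U" using T(2) by (meson IntD2 open_contains_ball)
  show thesis
  proof
    show "0 < e" by (rule e)
    fix x :: real assume "0 < x" "x < e"
    then have "x \<in> U" using e by auto
    then show "x \<notin> H" using T U assms(2) by auto
  qed
qed

theorem theorem3p1:
  fixes \<alpha> :: real and \<mu> :: "real measure" and H :: "real set"
  assumes "0 < \<alpha>" and "\<alpha> < 1"
    and "lsv_SRB \<alpha> \<mu>"
    and "H \<subset> {0..1}" and "H \<in> sets \<mu>"
    and "0 < measure \<mu> H" and "measure \<mu> H < 1"
    and "0 \<notin> (top_of_set {0..1}) closure_of H"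
    and "(top_of_set {0..1}) interior_of H \<noteq> {}"
  shows "\<exists>C\<ge>1. \<forall>n::nat. n \<ge> 1 \<longrightarrow>
           inverse C * real n powr (1 - 1/\<alpha>)
             \<le> measure \<mu> {x \<in> {0..1}. hitting_time (lsv \<alpha>) H x > enat n} \<and>
           measure \<mu> {x \<in> {0..1}. hitting_time (lsv \<alpha>) H x > enat n}
             \<le> C * real n powr (1 - 1/\<alpha>)"
proof -
  interpret lsv_acim \<alpha> \<mu>
    by unfold_locales (use assms in auto)
  obtain r where r: "0 < r" "\<And>x. 0 < x \<Longrightarrow> x < r \<Longrightarrow> x \<notin> H"
    using gap_at_zero[of H] assms(4,8) by blast
  obtain a b where ab: "0 \<le> a" "a < b" "b \<le> 1" "{a<..<b} \<subseteq> H"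
    using interval_in_relative_interior[OF assms(9)] by blast
  obtain c where c: "0 < c" "\<And>n. 1 \<le> n \<Longrightarrow> c * real n powr (1 - 1 / \<alpha>) \<le>
      measure \<mu> {x \<in> {0..1}. hitting_time (lsv \<alpha>) H x > enat n}"
    using hitting_tail_lower[OF assms(5) r] by blast
  obtain D where D: "0 < D" "\<And>n. 1 \<le> n \<Longrightarrow>
      measure \<mu> {x \<in> {0..1}. hitting_time (lsv \<alpha>) H x > enat n} \<le> D * real n powr (1 - 1 / \<alpha>)"
    using hitting_tail_upper[OF ab] by blast
  define C where "C = max 1 (max (inverse c) D)"
  have "inverse c \<le> C" "D \<le> C" "1 \<le> C" by (auto simp: C_def)
  moreover from this have "inverse C \<le> c"
    using c(1) le_imp_inverse_le[of "inverse c" C] by simp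
  ultimately show ?thesis
    using c(2) D(2) by (intro exI[of _ C]) (meson mult_right_mono order_trans powr_ge_zero)
qed

end
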